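(* Let $u,v\in A_N$ be commuting even permutations, viewed as permutation matrices acting on $\mathbb C^N$, and let $T=\langle u,v\rangle$. Then: (1) $T$ satisfies the parity condition (PC) if and only if $u^*(\xi_v)=\xi_v$ and $v^*(\xi_u)=\xi_u$; (2) if $T$ does not satisfy (PC), then $u^*(\xi_v)=-\xi_v$ or $v^*(\xi_u)=-\xi_u$.
   Context: Parity condition (PC) for a group $T$ of permutations of coordinates of $\mathbb C^N$: for every subgroup $T'\subseteq T$, $\dim(\mathbb C^N)^{T'}\equiv N\pmod 2$. For a linear map $w$ let $\mathrm{Fix}(w)$ be its eigenvalue-1 subspace and $M_w$ the sum of its other eigenspaces; $\xi_w$ is a formal generator, and for $v$ commuting with $w$ the action is $v^*(\xi_w)=\det(v|_{M_w})^{-1}\xi_w$. *)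

theory Defs
  imports "HOL-Analysis.Analysis" "HOL-Combinatorics.Permutations"
begin

text \<open>Coordinates of C^N are indexed by a finite type 'n, N = CARD('n).
  Linear algebra over C uses the interpretation vec (scalar multiplication *s).\<close>

text \<open>Permutation matrix of p: sends the standard basis vector e_j to e_(p j).\<close>
definition perm_mat :: "('n::finite \<Rightarrow> 'n) \<Rightarrow> complex^'n^'n" where
  "perm_mat p = (\<chi> i j. if i = p j then 1 else 0)"

text \<open>Eigenvalue-1 subspace of a linear map.\<close>
definition Fix :: "complex^'n^'n \<Rightarrow> (complex^'n) set" where
  "Fix A = {x. A *v x = x}"

text \<open>Sum of the eigenspaces of A for eigenvalues different from 1.\<close>
definition M_sp :: "complex^'n^'n \<Rightarrow> (complex^'n) set" where
  "M_sp A = vec.span (\<Union>c\<in>- {1}. {x. A *v x = c *s x})"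

text \<open>Leibniz determinant of a k x k matrix given by entries B i j, i, j < k.\<close>
definition det_fn :: "nat \<Rightarrow> (nat \<Rightarrow> nat \<Rightarrow> complex) \<Rightarrow> complex" where
  "det_fn k B = (\<Sum>p | p permutes {..<k}. of_int (sign p) * (\<Prod>i<k. B i (p i)))"

text \<open>b 0, ..., b (k-1) is a basis (over C) of the subspace S.\<close>
definition is_cbasis :: "(complex^'n) set \<Rightarrow> nat \<Rightarrow> (nat \<Rightarrow> complex^'n) \<Rightarrow> bool" where
  "is_cbasis S k b \<longleftrightarrow> inj_on b {..<k} \<and> vec.independent (b ` {..<k})
     \<and> vec.span (b ` {..<k}) = S"

text \<open>Determinant of the restriction of A to an A-invariant subspace S, computed
  as the determinant of the matrix of A with respect to a basis of S.\<close>
definition det_on :: "complex^'n^'n \<Rightarrow> (complex^'n) set \<Rightarrow> complex" where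
  "det_on A S = (SOME d. \<exists>k b B. is_cbasis S k b
      \<and> (\<forall>j<k. A *v b j = (\<Sum>i<k. B i j *s b i)) \<and> d = det_fn k B)"

text \<open>For commuting v, w: v^*(xi_w) = pullback_coeff v w * xi_w, where
  pullback_coeff v w = det(v restricted to M_w)^(-1).\<close>
definition pullback_coeff :: "complex^'n^'n \<Rightarrow> complex^'n^'n \<Rightarrow> complex" where
  "pullback_coeff v w = inverse (det_on v (M_sp w))"

text \<open>Subgroup of the permutation group of 'n generated by a set S of permutations.\<close>
inductive_set perm_gen :: "('n \<Rightarrow> 'n) set \<Rightarrow> ('n \<Rightarrow> 'n) set" for S where
  gen_id: "id \<in> perm_gen S"
| gen_base: "g \<in> S \<Longrightarrow> g \<in> perm_gen S"
| gen_comp: "g \<in> perm_gen S \<Longrightarrow> h \<in> perm_gen S \<Longrightarrow> g \<circ> h \<in> perm_gen S"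
| gen_inv: "g \<in> perm_gen S \<Longrightarrow> inv g \<in> perm_gen S"

text \<open>H is a subgroup of the permutation group T.\<close>
definition is_subgroup :: "('n \<Rightarrow> 'n) set \<Rightarrow> ('n \<Rightarrow> 'n) set \<Rightarrow> bool" where
  "is_subgroup H T \<longleftrightarrow> H \<subseteq> T \<and> id \<in> H \<and> (\<forall>g\<in>H. \<forall>h\<in>H. g \<circ> h \<in> H)
     \<and> (\<forall>g\<in>H. inv g \<in> H)"

text \<open>Subspace of C^N fixed by all elements of a group of coordinate permutations.\<close>
definition fixed_space :: "('n::finite \<Rightarrow> 'n) set \<Rightarrow> (complex^'n) set" where
  "fixed_space H = {x. \<forall>g\<in>H. perm_mat g *v x = x}"

text \<open>Parity condition (PC).\<close>
definition parity_condition :: "('n::finite \<Rightarrow> 'n) set \<Rightarrow> bool" where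
  "parity_condition T \<longleftrightarrow> (\<forall>H. is_subgroup H T \<longrightarrow>
      even (vec.dim (fixed_space H) + CARD('n)))"

end

theory Submission
  imports
    Defs "HOL-Combinatorics.Cycles" "HOL-Combinatorics.Orbits" "Jordan_Normal_Form.Determinant"
begin

text \<open>
  For a set H of coordinate permutations, the H-invariant vectors are exactly the vectors that are
  constant on the orbits of the generated group, so dim Fix(H) is the number of orbits and (PC) is
  a statement about parities of orbit counts.  A permutation g commuting with H permutes the
  H-orbits, and the cycles of this induced permutation are the orbits of <H, g>; as a permutation
  of a finite set S with c cycles has sign (-1)^(|S| - c), its sign is (-1) to the number of
  H-orbits minus the number of <H, g>-orbits.  Hence adjoining a square g o g never changes the
  parity of the orbit count, and N + #orbits(w) is even for an even permutation w.  Every element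
  of T = <u, v> is one of id, u, v, u o v times a square, so every subgroup H has the orbit parity
  of <H, T^2> = <R, T^2> for some R contained in {u, v, u o v}: (PC) holds iff N + #orbits(T) is
  even.

  On the other side, C^N = Fix(u) + M_u is a direct sum (Fourier decomposition along the powers
  of u), both summands are v-invariant, v permutes the indicator vectors of the u-orbits, which
  form a basis of Fix(u), and det v = 1.  So det(v|M_u) is the sign of the permutation induced by
  v on the u-orbits, which by the above (u being even) is (-1)^(N + #orbits(T)); symmetrically
  for u on M_v.  Both pull-back coefficients are therefore this same sign.
\<close>

section \<open>Parity of a permutation and the number of its cycles\<close>

lemma evenperm_cycle_of_list:
  assumes "distinct cs" "cs \<noteq> []"
  shows "evenperm (cycle_of_list cs) \<longleftrightarrow> odd (length cs)"
  using assms
proof (induction cs rule: cycle_of_list.induct)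
  case (1 i j cs)
  have "evenperm (cycle_of_list (i # j # cs))
      \<longleftrightarrow> (evenperm (Transposition.transpose i j) \<longleftrightarrow> evenperm (cycle_of_list (j # cs)))"
    unfolding cycle_of_list.simps(1)
    by (rule evenperm_comp[OF permutation_swap_id permutation_of_cycle])
  also have "\<dots> \<longleftrightarrow> \<not> evenperm (cycle_of_list (j # cs))"
    using 1(2) by (simp add: evenperm_swap)
  also have "\<dots> \<longleftrightarrow> odd (length (i # j # cs))"
    using 1 by simp
  finally show ?case .
qed auto

lemma set_support_eq_orbit:
  assumes "permutation p" shows "set (support p a) = orbit p a"
  unfolding support_set[OF assms] orbit_altdef_permutation[OF assms] by auto

lemma cycle_of_support_comp_perm_restrict:
  assumes p: "p permutes S" "finite S"
  shows "cycle_of_list (support p s) \<circ> perm_restrict p (S - orbit p s) = p"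
proof
  fix a
  have perm: "permutation p" using p permutation_permutes by blast
  have C: "set (support p s) = orbit p s" by (rule set_support_eq_orbit[OF perm])
  have cyc: "cyclic_on p (orbit p s)" by (rule cyclic_on_orbit[OF p])
  consider "a \<in> orbit p s" | "a \<in> S" "a \<notin> orbit p s" | "a \<notin> S" "a \<notin> orbit p s" by blast
  then show "(cycle_of_list (support p s) \<circ> perm_restrict p (S - orbit p s)) a = p a"
  proof cases
    case 1
    then show ?thesis using cycle_restrict[OF perm, of a s] C by (simp add: perm_restrict_simps)
  next
    case 2
    then have "p a \<notin> orbit p s" using cyclic_on_f_in[OF p(1) cyc] by blast
    with 2 C show ?thesis by (simp add: perm_restrict_simps id_outside_supp)
  next
    case 3
    with C permutes_not_in[OF p(1)] show ?thesis by (simp add: perm_restrict_simps id_outside_supp)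
  qed
qed

lemma orbits_perm_restrict:
  assumes p: "p permutes S" "finite S" and s: "s \<in> S"
  defines "C \<equiv> orbit p s"
  shows "orbit p ` S = insert C (orbit (perm_restrict p (S - C)) ` (S - C))"
    and "C \<notin> orbit (perm_restrict p (S - C)) ` (S - C)"
proof -
  let ?q = "perm_restrict p (S - C)"
  have cyc: "cyclic_on p C" unfolding C_def by (rule cyclic_on_orbit[OF p])
  have q: "?q permutes S - C" by (rule perm_restrict_diff_cyclic[OF p(1) cyc])
  have "orbit ?q y = orbit p y" if "y \<in> S - C" for y
    by (rule orbit_cong0[OF that]) (use permutes_in_image[OF q] in \<open>auto simp: perm_restrict_simps\<close>)
  moreover have "orbit p y = C" if "y \<in> C" for y by (rule orbit_cyclic_eq3[OF cyc that])
  moreover have "C \<subseteq> S" "s \<in> C"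
    unfolding C_def using permutes_orbit_subset[OF p(1) s]
      permutation_self_in_orbit[OF permutes_imp_permutation[OF p(2,1)]] by auto
  ultimately show "orbit p ` S = insert C (orbit ?q ` (S - C))" by blast
  have "y \<in> orbit ?q y" for y
    using permutation_self_in_orbit[OF permutes_imp_permutation[OF _ q]] p(2) by simp
  then show "C \<notin> orbit ?q ` (S - C)" by blast
qed

theorem evenperm_iff_card_orbits:
  assumes "p permutes S" "finite S"
  shows "evenperm p \<longleftrightarrow> even (card S + card (orbit p ` S))"
  using assms(2,1)
proof (induction S arbitrary: p rule: finite_psubset_induct)
  case (psubset S)
  show ?case
  proof (cases "S = {}")
    case True
    with psubset.prems show ?thesis by (simp add: permutes_empty)
  next
    case False
    then obtain s where s: "s \<in> S" by blast
    define C where "C = orbit p s"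
    define q where "q = perm_restrict p (S - C)"
    have perm: "permutation p" using psubset permutation_permutes by blast
    have cyc: "cyclic_on p C" unfolding C_def
      by (rule cyclic_on_orbit[OF psubset.prems psubset.hyps(1)])
    have q: "q permutes S - C" unfolding q_def
      by (rule perm_restrict_diff_cyclic[OF psubset.prems cyc])
    have CS: "C \<subseteq> S" and sC: "s \<in> C"
      unfolding C_def
        using permutes_orbit_subset[OF psubset.prems s] permutation_self_in_orbit[OF perm]
      by auto
    have IH: "evenperm q \<longleftrightarrow> even (card (S - C) + card (orbit q ` (S - C)))"
      using psubset.IH[OF _ q] sC s by blast
    have supp: "distinct (support p s)" "set (support p s) = C"
      using cycle_of_permutation[OF perm] set_support_eq_orbit[OF perm] unfolding C_def by auto
    have "evenperm p \<longleftrightarrow> evenperm (cycle_of_list (support p s) \<circ> q)"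
      using cycle_of_support_comp_perm_restrict[OF psubset.prems psubset.hyps(1), of s]
      unfolding q_def C_def by simp
    also have "\<dots> \<longleftrightarrow> (evenperm (cycle_of_list (support p s)) \<longleftrightarrow> evenperm q)"
      using psubset.hyps(1)
      by (intro evenperm_comp permutation_of_cycle permutes_imp_permutation[OF _ q]) simp
    also have "evenperm (cycle_of_list (support p s)) \<longleftrightarrow> odd (card C)"
      using evenperm_cycle_of_list[OF supp(1)] supp sC distinct_card[OF supp(1)] by auto
    finally have ev: "evenperm p \<longleftrightarrow> (odd (card C) \<longleftrightarrow> evenperm q)" .
    have "card (orbit p ` S) = Suc (card (orbit q ` (S - C)))"
      using orbits_perm_restrict[OF psubset.prems psubset.hyps(1) s] psubset.hyps(1)
      unfolding q_def C_def by simp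
    moreover have "card S = card C + card (S - C)"
      using CS psubset.hyps(1) by (simp add: card_Diff_subset card_mono finite_subset)
    ultimately show ?thesis using ev IH by presburger
  qed
qed

section \<open>Orbits of the group generated by a set of permutations\<close>

lemma perm_gen_bij:
  assumes "\<forall>g\<in>G. bij g" "h \<in> perm_gen G" shows "bij h"
  using assms(2) by induction (use assms(1) in \<open>blast intro: bij_id bij_comp bij_imp_bij_inv\<close>)+

lemma perm_gen_subset:
  assumes "A \<subseteq> perm_gen B" shows "perm_gen A \<subseteq> perm_gen B"
proof
  fix h assume "h \<in> perm_gen A"
  then show "h \<in> perm_gen B"
    by induction (use assms in \<open>blast intro: perm_gen.intros\<close>)+
qed

lemma perm_gen_eqI: "A \<subseteq> perm_gen B \<Longrightarrow> B \<subseteq> perm_gen A \<Longrightarrow> perm_gen A = perm_gen B"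
  using perm_gen_subset by blast

lemma perm_gen_empty: "perm_gen {} = {id}"
proof -
  have "h = id" if "h \<in> perm_gen {}" for h :: "'a \<Rightarrow> 'a"
    using that by induction auto
  then show ?thesis using perm_gen.gen_id by blast
qed

lemma perm_gen_subgroup:
  assumes "is_subgroup H T" shows "perm_gen H = H"
proof
  have H: "id \<in> H" "\<forall>g\<in>H. \<forall>h\<in>H. g \<circ> h \<in> H" "\<forall>g\<in>H. inv_into UNIV g \<in> H"
    using assms unfolding is_subgroup_def by auto
  show "perm_gen H \<subseteq> H"
  proof
    fix h assume "h \<in> perm_gen H"
    then show "h \<in> H" by induction (use H in blast)+
  qed
qed (blast intro: perm_gen.gen_base)

lemma perm_gen_funpow: "g \<in> perm_gen G \<Longrightarrow> g ^^ n \<in> perm_gen G"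
  by (induction n) (auto intro: perm_gen.intros)

lemma perm_gen_commute:
  assumes "\<forall>g\<in>G. bij g" "\<forall>g\<in>G. f \<circ> g = g \<circ> f" "h \<in> perm_gen G"
  shows "f \<circ> h = h \<circ> f"
  using assms(3)
proof induction
  case (gen_comp g h)
  then show ?case by (metis comp_assoc)
next
  case (gen_inv g)
  have g: "bij g" by (rule perm_gen_bij[OF assms(1) gen_inv(1)])
  have "f \<circ> inv_into UNIV g = (inv_into UNIV g \<circ> g) \<circ> f \<circ> inv_into UNIV g"
    using inj_iff[THEN iffD1, OF bij_is_inj[OF g]] by simp
  also have "\<dots> = inv_into UNIV g \<circ> (f \<circ> g) \<circ> inv_into UNIV g"
    by (simp only: gen_inv(2) comp_assoc)
  also have "\<dots> = inv_into UNIV g \<circ> f"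
    using surj_iff[THEN iffD1, OF bij_is_surj[OF g]] by (simp add: comp_assoc)
  finally show ?case .
qed (use assms(2) in auto)

lemma perm_gen_commutative:
  assumes G: "\<forall>g\<in>G. bij g" and comm: "\<forall>g\<in>G. \<forall>h\<in>G. g \<circ> h = h \<circ> g"
    and "a \<in> perm_gen G" "b \<in> perm_gen G"
  shows "a \<circ> b = b \<circ> a"
proof -
  have "a \<circ> g = g \<circ> a" if "g \<in> G" for g
    using perm_gen_commute[OF G bspec[OF comm that] assms(3)] by (rule sym)
  then show ?thesis using perm_gen_commute[OF G _ assms(4)] by blast
qed

lemma funpow_commute:
  assumes "f \<circ> k = k \<circ> f" shows "(f ^^ i) \<circ> k = k \<circ> (f ^^ i)"
proof (induction i)
  case (Suc i)
  have "(f ^^ Suc i) \<circ> k = f \<circ> ((f ^^ i) \<circ> k)" by (simp add: comp_assoc)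
  also have "\<dots> = (f \<circ> k) \<circ> (f ^^ i)" by (simp only: Suc comp_assoc)
  also have "\<dots> = k \<circ> (f ^^ Suc i)" by (simp only: assms comp_assoc funpow.simps(2))
  finally show ?case .
qed simp

lemma bij_funpow_eq_id:
  fixes g :: "'a::finite \<Rightarrow> 'a"
  assumes "bij g" obtains n where "n > 0" "g ^^ n = id"
proof -
  have "permutation g"
    using assms by (intro permutes_imp_permutation[of UNIV] bij_imp_permutes) auto
  then show ?thesis using permutation_is_nilpotent that by blast
qed

lemma inv_funpow_eq_funpow:
  assumes g: "bij g" and n: "n > 0" "g ^^ n = id"
  shows "inv_into UNIV (g ^^ i) = g ^^ (i * (n - 1))"
proof -
  have "(g ^^ i) \<circ> (g ^^ (i * (n - 1))) = g ^^ (i * n)"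
    using n(1) by (simp add: funpow_add[symmetric] algebra_simps)
  also have "\<dots> = id" by (metis funpow_mult n(2) id_funpow mult.commute)
  finally show ?thesis
    using bij_betw_funpow[OF g]
    by (metis bij_is_inj inv_o_cancel left_right_inverse_eq o_inv_o_cancel)
qed

lemma perm_gen_insert:
  fixes g :: "'a::finite \<Rightarrow> 'a"
  assumes G: "\<forall>h\<in>G. bij h" and g: "bij g" and c: "\<forall>h\<in>G. g \<circ> h = h \<circ> g"
  shows "perm_gen (insert g G) = {k \<circ> (g ^^ i) | k i. k \<in> perm_gen G}"
proof
  obtain n where n: "n > 0" "g ^^ n = id" using bij_funpow_eq_id[OF g] by blast
  have com: "k \<circ> (g ^^ i) = (g ^^ i) \<circ> k" if "k \<in> perm_gen G" for k i
    using funpow_commute[OF perm_gen_commute[OF G c that]] by simp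
  show "perm_gen (insert g G) \<subseteq> {k \<circ> (g ^^ i) | k i. k \<in> perm_gen G}"
  proof
    fix x assume "x \<in> perm_gen (insert g G)"
    then show "x \<in> {k \<circ> (g ^^ i) | k i. k \<in> perm_gen G}"
    proof induction
      case gen_id
      have "id = id \<circ> (g ^^ 0)" by simp
      then show ?case using perm_gen.gen_id by blast
    next
      case (gen_base h)
      have "g = id \<circ> (g ^^ 1)" "h = h \<circ> (g ^^ 0)" by simp_all
      with gen_base show ?case by (blast intro: perm_gen.gen_id perm_gen.gen_base)
    next
      case (gen_comp a b)
      then obtain k i k' j where kk: "k \<in> perm_gen G" "a = k \<circ> (g ^^ i)"
        "k' \<in> perm_gen G" "b = k' \<circ> (g ^^ j)"
        by blast
      have "a \<circ> b = k \<circ> ((g ^^ i) \<circ> k') \<circ> (g ^^ j)" using kk by (simp add: comp_assoc)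
      also have "\<dots> = (k \<circ> k') \<circ> (g ^^ (i + j))"
        by (simp only: com[OF kk(3), of i, symmetric] comp_assoc funpow_add)
      finally show ?case using perm_gen.gen_comp[OF kk(1,3)] by blast
    next
      case (gen_inv a)
      then obtain k i where kk: "k \<in> perm_gen G" "a = k \<circ> (g ^^ i)" by blast
      have "inv_into UNIV a = inv_into UNIV (g ^^ i) \<circ> inv_into UNIV k"
        unfolding kk(2) using perm_gen_bij[OF G kk(1)] bij_betw_funpow[OF g]
        by (simp add: o_inv_distrib)
      then have "inv_into UNIV a = inv_into UNIV k \<circ> (g ^^ (i * (n - 1)))"
        using com[OF perm_gen.gen_inv[OF kk(1)]] inv_funpow_eq_funpow[OF g n] by simp
      then show ?case using perm_gen.gen_inv[OF kk(1)] by blast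
    qed
  qed
  show "{k \<circ> (g ^^ i) | k i. k \<in> perm_gen G} \<subseteq> perm_gen (insert g G)"
  proof clarify
    fix k i assume "k \<in> perm_gen G"
    then have "k \<in> perm_gen (insert g G)"
      using perm_gen_subset[of G "insert g G"] by (blast intro: perm_gen.gen_base)
    moreover have "g ^^ i \<in> perm_gen (insert g G)"
      by (intro perm_gen_funpow perm_gen.gen_base) simp
    ultimately show "k \<circ> (g ^^ i) \<in> perm_gen (insert g G)" by (rule perm_gen.gen_comp)
  qed
qed

lemma orbit_eq_iff:
  assumes "permutation f" shows "orbit f x = orbit f y \<longleftrightarrow> y \<in> orbit f x"
  using permutation_self_in_orbit[OF assms, of y] orbit_cyclic_eq3[OF cyclic_on_orbit'[OF assms]]
  by metis

lemma card_range_eq_if_same_fibres: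
  assumes "\<And>x y. F x = F y \<longleftrightarrow> F' x = F' y"
  shows "card (range F) = card (range F')"
proof -
  have phi: "(F' \<circ> inv_into UNIV F) (F x) = F' x" for x
    using assms f_inv_into_f[of "F x" F UNIV] by auto
  have "inj_on (F' \<circ> inv_into UNIV F) (range F)"
    by (rule inj_onI) (use phi assms in auto)
  moreover have "(F' \<circ> inv_into UNIV F) ` range F = range F'"
    using phi by (auto simp: image_iff)
  ultimately show ?thesis by (metis card_image)
qed

definition gen_orbit :: "('a \<Rightarrow> 'a) set \<Rightarrow> 'a \<Rightarrow> 'a set" where
  "gen_orbit G x = (\<lambda>h. h x) ` perm_gen G"

definition gen_orbits :: "('a \<Rightarrow> 'a) set \<Rightarrow> 'a set set" where
  "gen_orbits G = range (gen_orbit G)"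

lemma gen_orbit_self: "x \<in> gen_orbit G x"
  unfolding gen_orbit_def by (rule image_eqI[OF _ perm_gen.gen_id]) simp

lemma gen_orbit_trans:
  assumes "y \<in> gen_orbit G x" "z \<in> gen_orbit G y" shows "z \<in> gen_orbit G x"
proof -
  obtain h k where hk: "h \<in> perm_gen G" "k \<in> perm_gen G" "y = h x" "z = k y"
    using assms unfolding gen_orbit_def by blast
  have "k \<circ> h \<in> perm_gen G" by (rule perm_gen.gen_comp[OF hk(2,1)])
  moreover have "z = (k \<circ> h) x" using hk by simp
  ultimately show ?thesis unfolding gen_orbit_def by blast
qed

lemma gen_orbit_sym:
  assumes "\<forall>g\<in>G. bij g" "y \<in> gen_orbit G x" shows "x \<in> gen_orbit G y"
proof -
  obtain h where h: "h \<in> perm_gen G" "y = h x" using assms(2) unfolding gen_orbit_def by blast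
  have "inv_into UNIV h y = x" using perm_gen_bij[OF assms(1) h(1)] h(2) by (simp add: bij_is_inj)
  then show ?thesis unfolding gen_orbit_def using perm_gen.gen_inv[OF h(1)] by blast
qed

lemma gen_orbit_eq_iff:
  assumes "\<forall>g\<in>G. bij g" shows "gen_orbit G x = gen_orbit G y \<longleftrightarrow> y \<in> gen_orbit G x"
proof
  assume "gen_orbit G x = gen_orbit G y"
  then show "y \<in> gen_orbit G x" using gen_orbit_self[of y G] by simp
next
  assume y: "y \<in> gen_orbit G x"
  show "gen_orbit G x = gen_orbit G y"
    using gen_orbit_trans[OF y] gen_orbit_trans[OF gen_orbit_sym[OF assms y]] by blast
qed

lemma gen_orbits_disjoint:
  assumes "\<forall>g\<in>G. bij g" "X \<in> gen_orbits G" "Y \<in> gen_orbits G" "y \<in> X" "y \<in> Y"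
  shows "X = Y"
proof -
  obtain a b where "X = gen_orbit G a" "Y = gen_orbit G b"
    using assms(2,3) unfolding gen_orbits_def by blast
  with assms(4,5) gen_orbit_eq_iff[OF assms(1)] show ?thesis by metis
qed

lemma gen_orbits_cong: "perm_gen A = perm_gen B \<Longrightarrow> gen_orbits A = gen_orbits B"
  unfolding gen_orbits_def gen_orbit_def by simp

lemma finite_gen_orbits: "finite (gen_orbits (G :: ('a::finite \<Rightarrow> 'a) set))"
  by (rule finite_subset[OF subset_UNIV]) simp

lemma image_gen_orbit:
  assumes "\<forall>h\<in>G. bij h" "\<forall>h\<in>G. g \<circ> h = h \<circ> g"
  shows "g ` gen_orbit G x = gen_orbit G (g x)"
proof -
  have "g (h x) = h (g x)" if "h \<in> perm_gen G" for h
    using perm_gen_commute[OF assms that] by (metis comp_apply)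
  then show ?thesis unfolding gen_orbit_def image_image by (intro image_cong) auto
qed

definition orbit_perm :: "('a \<Rightarrow> 'a) set \<Rightarrow> ('a \<Rightarrow> 'a) \<Rightarrow> 'a set \<Rightarrow> 'a set" where
  "orbit_perm G g = restrict_id (image g) (gen_orbits G)"

context
  fixes G :: "('a::finite \<Rightarrow> 'a) set" and g :: "'a \<Rightarrow> 'a"
  assumes G: "\<forall>h\<in>G. bij h" and g: "bij g" and commute: "\<forall>h\<in>G. g \<circ> h = h \<circ> g"
begin

lemma orbit_perm_gen_orbit: "orbit_perm G g (gen_orbit G x) = gen_orbit G (g x)"
  unfolding orbit_perm_def using image_gen_orbit[OF G commute] by (simp add: gen_orbits_def)

lemma orbit_perm_permutes: "orbit_perm G g permutes gen_orbits G"
  unfolding orbit_perm_def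
proof (rule permutes_restrict_id, rule bij_betw_imageI)
  show "inj_on (image g) (gen_orbits G)"
    by (rule inj_onI) (simp add: inj_image_eq_iff[OF bij_is_inj[OF g]])
  have "image g ` gen_orbits G = (\<lambda>x. gen_orbit G (g x)) ` UNIV"
    unfolding gen_orbits_def image_image using image_gen_orbit[OF G commute] by simp
  also have "\<dots> = gen_orbit G ` range g" by (simp only: image_image)
  also have "\<dots> = gen_orbits G" unfolding gen_orbits_def using bij_is_surj[OF g] by simp
  finally show "image g ` gen_orbits G = gen_orbits G" .
qed

lemma orbit_perm_funpow: "(orbit_perm G g ^^ i) (gen_orbit G x) = gen_orbit G ((g ^^ i) x)"
  by (induction i) (simp_all add: orbit_perm_gen_orbit)

lemma card_gen_orbits_insert:
  "card (gen_orbits (insert g G)) = card (orbit (orbit_perm G g) ` gen_orbits G)"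
proof -
  have perm: "permutation (orbit_perm G g)"
    by (rule permutes_imp_permutation[OF finite_gen_orbits orbit_perm_permutes])
  have G': "\<forall>h\<in>insert g G. bij h" using G g by blast
  have "orbit (orbit_perm G g) (gen_orbit G x) = orbit (orbit_perm G g) (gen_orbit G y)
      \<longleftrightarrow> gen_orbit (insert g G) x = gen_orbit (insert g G) y" for x y
  proof -
    have "orbit (orbit_perm G g) (gen_orbit G x) = orbit (orbit_perm G g) (gen_orbit G y)
        \<longleftrightarrow> gen_orbit G y \<in> orbit (orbit_perm G g) (gen_orbit G x)"
      by (rule orbit_eq_iff[OF perm])
    also have "\<dots> \<longleftrightarrow> (\<exists>i. gen_orbit G ((g ^^ i) x) = gen_orbit G y)"
      unfolding orbit_altdef_permutation[OF perm] orbit_perm_funpow by auto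
    also have "\<dots> \<longleftrightarrow> (\<exists>i. y \<in> gen_orbit G ((g ^^ i) x))"
      using gen_orbit_eq_iff[OF G] by simp
    also have "\<dots> \<longleftrightarrow> (\<exists>i. \<exists>k\<in>perm_gen G. y = (k \<circ> g ^^ i) x)"
      unfolding gen_orbit_def by auto
    also have "\<dots> \<longleftrightarrow> y \<in> gen_orbit (insert g G) x"
      unfolding gen_orbit_def perm_gen_insert[OF G g commute] by blast
    also have "\<dots> \<longleftrightarrow> gen_orbit (insert g G) x = gen_orbit (insert g G) y"
      by (rule gen_orbit_eq_iff[OF G', symmetric])
    finally show ?thesis .
  qed
  then have "card (range (\<lambda>x. orbit (orbit_perm G g) (gen_orbit G x)))
      = card (range (gen_orbit (insert g G)))"
    by (rule card_range_eq_if_same_fibres)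
  then show ?thesis unfolding gen_orbits_def by (simp add: image_image)
qed

theorem evenperm_orbit_perm_iff:
  "evenperm (orbit_perm G g) \<longleftrightarrow> even (card (gen_orbits G) + card (gen_orbits (insert g G)))"
  using evenperm_iff_card_orbits[OF orbit_perm_permutes finite_gen_orbits]
  by (simp add: card_gen_orbits_insert)

end

lemma orbit_perm_comp:
  fixes G :: "('a::finite \<Rightarrow> 'a) set"
  assumes G: "\<forall>k\<in>G. bij k" and g: "bij g" "\<forall>k\<in>G. g \<circ> k = k \<circ> g"
    and h: "bij h" "\<forall>k\<in>G. h \<circ> k = k \<circ> h"
  shows "orbit_perm G (g \<circ> h) = orbit_perm G g \<circ> orbit_perm G h"
proof
  fix X show "orbit_perm G (g \<circ> h) X = (orbit_perm G g \<circ> orbit_perm G h) X"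
  proof (cases "X \<in> gen_orbits G")
    case True
    then obtain x where x: "X = gen_orbit G x" unfolding gen_orbits_def by blast
    have "bij (g \<circ> h)" using g h bij_comp by blast
    moreover have "\<forall>k\<in>G. (g \<circ> h) \<circ> k = k \<circ> (g \<circ> h)"
      using g(2) h(2) by (metis comp_assoc)
    ultimately show ?thesis
      unfolding x using orbit_perm_gen_orbit[OF G] g h by simp
  next
    case False
    then show ?thesis unfolding orbit_perm_def by simp
  qed
qed

lemma even_card_gen_orbits_insert_square:
  fixes G :: "('a::finite \<Rightarrow> 'a) set"
  assumes G: "\<forall>h\<in>G. bij h" and g: "bij g" and c: "\<forall>h\<in>G. g \<circ> h = h \<circ> g"
  shows "even (card (gen_orbits G) + card (gen_orbits (insert (g \<circ> g) G)))"
proof -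
  have "bij (g \<circ> g)" using g bij_comp by blast
  moreover have "\<forall>h\<in>G. (g \<circ> g) \<circ> h = h \<circ> (g \<circ> g)" using c by (metis comp_assoc)
  moreover have "permutation (orbit_perm G g)"
    by (rule permutes_imp_permutation[OF finite_gen_orbits orbit_perm_permutes[OF G g c]])
  then have "evenperm (orbit_perm G (g \<circ> g))"
    unfolding orbit_perm_comp[OF G g c g c] by (simp add: evenperm_comp)
  ultimately show ?thesis using evenperm_orbit_perm_iff[OF G] by blast
qed

lemma gen_orbits_empty: "gen_orbits {} = (\<lambda>x. {x}) ` UNIV"
  unfolding gen_orbits_def gen_orbit_def perm_gen_empty by simp

lemma card_gen_orbits_empty: "card (gen_orbits ({} :: ('a::finite \<Rightarrow> 'a) set)) = CARD('a)"
  unfolding gen_orbits_empty by (simp add: card_image)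

lemma orbit_perm_empty:
  fixes w :: "'a::finite \<Rightarrow> 'a"
  assumes "bij w"
  shows "orbit_perm {} w = map_permutation UNIV (\<lambda>x. {x}) w"
proof -
  have inj: "inj_on (\<lambda>x::'a. {x}) UNIV" by simp
  show ?thesis
    unfolding orbit_perm_def map_permutation_def gen_orbits_empty
  proof (rule restrict_id_cong)
    fix X assume "X \<in> (\<lambda>x::'a. {x}) ` UNIV"
    then obtain x where "X = {x}" by blast
    then show "w ` X = ((\<lambda>x. {x}) \<circ> w \<circ> inv_into UNIV (\<lambda>x. {x})) X"
      using inv_into_f_f[OF inj] by simp
  qed simp
qed

theorem evenperm_iff_card_gen_orbits:
  fixes w :: "'a::finite \<Rightarrow> 'a"
  assumes "bij w"
  shows "evenperm w \<longleftrightarrow> even (CARD('a) + card (gen_orbits {w}))"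
proof -
  have "w permutes UNIV" using assms by (intro bij_imp_permutes) auto
  then have "evenperm (orbit_perm {} w) \<longleftrightarrow> evenperm w"
    unfolding orbit_perm_empty[OF assms] by (intro evenperm_map_permutation) auto
  then show ?thesis
    using evenperm_orbit_perm_iff[of "{}" w] assms card_gen_orbits_empty[where 'a='a] by simp
qed

section \<open>Subgroups of a group generated by two commuting even permutations\<close>

lemma even_card_gen_orbits_Un_squares:
  fixes T :: "('a::finite \<Rightarrow> 'a) set"
  assumes T_bij: "\<forall>t\<in>T. bij t" and comm: "\<forall>a\<in>T. \<forall>b\<in>T. a \<circ> b = b \<circ> a"
    and sq: "\<forall>t\<in>T. t \<circ> t \<in> T" and GT: "G \<subseteq> T"
  shows "even (card (gen_orbits G) + card (gen_orbits (G \<union> (\<lambda>t. t \<circ> t) ` T)))"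
proof -
  have "even (card (gen_orbits G) + card (gen_orbits (G \<union> (\<lambda>t. t \<circ> t) ` F)))"
    if "finite F" "F \<subseteq> T" for F
    using that
  proof (induction F rule: finite_induct)
    case (insert t F)
    have GFT: "G \<union> (\<lambda>t. t \<circ> t) ` F \<subseteq> T" using insert.prems sq GT by blast
    have step: "even (card (gen_orbits (G \<union> (\<lambda>t. t \<circ> t) ` F))
        + card (gen_orbits (insert (t \<circ> t) (G \<union> (\<lambda>t. t \<circ> t) ` F))))"
    proof (rule even_card_gen_orbits_insert_square)
      show "\<forall>h\<in>G \<union> (\<lambda>t. t \<circ> t) ` F. bij h" using GFT T_bij by blast
      show "bij t" using insert.prems T_bij by blast
      show "\<forall>h\<in>G \<union> (\<lambda>t. t \<circ> t) ` F. t \<circ> h = h \<circ> t"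
        using GFT insert.prems comm by (meson insert_subset subsetD)
    qed
    have eq: "G \<union> (\<lambda>t. t \<circ> t) ` insert t F = insert (t \<circ> t) (G \<union> (\<lambda>t. t \<circ> t) ` F)"
      by blast
    have "even (card (gen_orbits G) + card (gen_orbits (G \<union> (\<lambda>t. t \<circ> t) ` F)))"
      using insert.IH insert.prems by blast
    with step show ?case unfolding eq by presburger
  qed simp
  then show ?thesis using finite[of T] by blast
qed

context
  fixes u v :: "'a::finite \<Rightarrow> 'a"
  assumes bu: "bij u" and bv: "bij v" and uv: "u \<circ> v = v \<circ> u"
begin

lemma perm_gen_pair_elem:
  assumes "h \<in> perm_gen {u, v}" shows "\<exists>i j. h = (v ^^ j) \<circ> (u ^^ i)"
proof -
  have "perm_gen (insert u {v}) = {k \<circ> (u ^^ i) | k i. k \<in> perm_gen {v}}"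
    by (rule perm_gen_insert) (use bu bv uv in auto)
  then obtain k i where k: "k \<in> perm_gen (insert v {})" "h = k \<circ> (u ^^ i)"
    using assms by auto
  have "perm_gen (insert v {}) = {k \<circ> (v ^^ j) | k j. k \<in> perm_gen {}}"
    by (rule perm_gen_insert) (use bv in auto)
  then obtain j where "k = v ^^ j" using k(1) by (auto simp: perm_gen_empty)
  with k show ?thesis by blast
qed

lemma funpow_pair_comp:
  "((v ^^ a) \<circ> (u ^^ b)) \<circ> ((v ^^ c) \<circ> (u ^^ d)) = (v ^^ (a + c)) \<circ> (u ^^ (b + d))"
proof -
  have "(u ^^ b) \<circ> v = v \<circ> (u ^^ b)" by (rule funpow_commute[OF uv])
  then have c: "(v ^^ c) \<circ> (u ^^ b) = (u ^^ b) \<circ> (v ^^ c)" by (rule funpow_commute[OF sym])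
  have "((v ^^ a) \<circ> (u ^^ b)) \<circ> ((v ^^ c) \<circ> (u ^^ d))
      = (v ^^ a) \<circ> ((u ^^ b) \<circ> (v ^^ c)) \<circ> (u ^^ d)"
    by (simp only: comp_assoc)
  also have "\<dots> = (v ^^ a) \<circ> (v ^^ c) \<circ> ((u ^^ b) \<circ> (u ^^ d))"
    by (simp only: c[symmetric] comp_assoc)
  also have "\<dots> = (v ^^ (a + c)) \<circ> (u ^^ (b + d))" by (simp only: funpow_add)
  finally show ?thesis .
qed

lemma perm_gen_pair_square_decomp:
  assumes "h \<in> perm_gen {u, v}"
  shows "\<exists>r\<in>{id, u, v, u \<circ> v}. \<exists>s\<in>perm_gen {u, v}. h = r \<circ> (s \<circ> s)"
proof -
  obtain i j where h: "h = (v ^^ j) \<circ> (u ^^ i)" using perm_gen_pair_elem[OF assms] by blast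
  define r where "r = (v ^^ (j mod 2)) \<circ> (u ^^ (i mod 2))"
  define s where "s = (v ^^ (j div 2)) \<circ> (u ^^ (i div 2))"
  have "s \<in> perm_gen {u, v}"
    unfolding s_def by (intro perm_gen.gen_comp perm_gen_funpow perm_gen.gen_base) simp_all
  moreover have "h = r \<circ> (s \<circ> s)"
    unfolding r_def s_def funpow_pair_comp h by (metis mod_div_mult_eq mult_2_right add.commute)
  moreover have "r \<in> {id, u, v, u \<circ> v}"
  proof -
    have "j mod 2 = 0 \<or> j mod 2 = 1" "i mod 2 = 0 \<or> i mod 2 = 1" by auto
    then show ?thesis unfolding r_def using uv by auto
  qed
  ultimately show ?thesis by blast
qed


lemma perm_gen_pair_eqI:
  assumes "(u \<in> R \<and> v \<in> R) \<or> (u \<in> R \<and> u \<circ> v \<in> R) \<or> (v \<in> R \<and> u \<circ> v \<in> R)"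
    and "R \<subseteq> perm_gen {u, v}"
  shows "perm_gen R = perm_gen {u, v}"
proof (rule perm_gen_eqI[OF assms(2)])
  have u_uv: "inv_into UNIV u \<circ> (u \<circ> v) = v"
    using bu by (simp add: comp_assoc[symmetric] inj_iff[THEN iffD1] bij_is_inj)
  have uv_v: "(u \<circ> v) \<circ> inv_into UNIV v = u"
    using bv by (simp add: comp_assoc surj_iff[THEN iffD1] bij_is_surj)
  have "u \<in> perm_gen R \<and> v \<in> perm_gen R"
    using assms(1)
  proof (elim disjE conjE)
    assume "u \<in> R" "v \<in> R"
    then show ?thesis by (blast intro: perm_gen.gen_base)
  next
    assume "u \<in> R" "u \<circ> v \<in> R"
    then have "u \<in> perm_gen R" "u \<circ> v \<in> perm_gen R" by (auto intro: perm_gen.gen_base)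
    then have "u \<in> perm_gen R" "inv_into UNIV u \<circ> (u \<circ> v) \<in> perm_gen R"
      by (auto intro: perm_gen.gen_comp perm_gen.gen_inv)
    then show ?thesis unfolding u_uv by blast
  next
    assume "v \<in> R" "u \<circ> v \<in> R"
    then have "v \<in> perm_gen R" "u \<circ> v \<in> perm_gen R" by (auto intro: perm_gen.gen_base)
    then have "v \<in> perm_gen R" "(u \<circ> v) \<circ> inv_into UNIV v \<in> perm_gen R"
      by (auto intro: perm_gen.gen_comp perm_gen.gen_inv)
    then show ?thesis unfolding uv_v by blast
  qed
  then show "{u, v} \<subseteq> perm_gen R" by blast
qed

lemma evenperm_comp_pair:
  assumes "evenperm u" "evenperm v" shows "evenperm (u \<circ> v)"
proof -
  have "permutation u" "permutation v"
    using bu bv by (auto intro!: permutes_imp_permutation[of UNIV] bij_imp_permutes)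
  then show ?thesis using assms by (simp add: evenperm_comp)
qed

lemma even_card_gen_orbits_subset_triple:
  assumes eu: "evenperm u" and ev: "evenperm v"
    and eT: "even (CARD('a) + card (gen_orbits {u, v}))"
    and R: "R \<subseteq> {u, v, u \<circ> v}"
  shows "even (CARD('a) + card (gen_orbits R))"
proof (cases "(u \<in> R \<and> v \<in> R) \<or> (u \<in> R \<and> u \<circ> v \<in> R) \<or> (v \<in> R \<and> u \<circ> v \<in> R)")
  case True
  have "u \<circ> v \<in> perm_gen {u, v}" by (rule perm_gen.gen_comp; rule perm_gen.gen_base; simp)
  then have "R \<subseteq> perm_gen {u, v}" using R by (blast intro: perm_gen.gen_base)
  then have "gen_orbits R = gen_orbits {u, v}"
    by (rule gen_orbits_cong[OF perm_gen_pair_eqI[OF True]])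
  with eT show ?thesis by simp
next
  case False
  then have "R = {} \<or> (\<exists>w\<in>{u, v, u \<circ> v}. R = {w})" using R by blast
  then show ?thesis
  proof
    assume "R = {}"
    then show ?thesis using card_gen_orbits_empty[where 'a='a] by simp
  next
    assume "\<exists>w\<in>{u, v, u \<circ> v}. R = {w}"
    then obtain w where w: "w \<in> {u, v, u \<circ> v}" "R = {w}" by blast
    then have "evenperm w" using eu ev evenperm_comp_pair[OF eu ev] by blast
    moreover have "bij w" using w bu bv bij_comp by blast
    ultimately show ?thesis using evenperm_iff_card_gen_orbits w(2) by blast
  qed
qed

lemma perm_gen_Un_squares_eq:
  assumes HT: "H \<subseteq> perm_gen {u, v}"
  defines "Sq \<equiv> (\<lambda>t. t \<circ> t) ` perm_gen {u, v}"
  shows "perm_gen (H \<union> Sq) = perm_gen ((perm_gen (H \<union> Sq) \<inter> {u, v, u \<circ> v}) \<union> Sq)"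
    (is "_ = perm_gen (?R \<union> Sq)")
proof (rule perm_gen_eqI)
  show "?R \<union> Sq \<subseteq> perm_gen (H \<union> Sq)" by (blast intro: perm_gen.gen_base)
  show "H \<union> Sq \<subseteq> perm_gen (?R \<union> Sq)"
  proof
    fix h assume h: "h \<in> H \<union> Sq"
    show "h \<in> perm_gen (?R \<union> Sq)"
    proof (cases "h \<in> H")
      case True
      then obtain r s where r: "r \<in> {id, u, v, u \<circ> v}" and s: "s \<in> perm_gen {u, v}"
        and hrs: "h = r \<circ> (s \<circ> s)"
        using perm_gen_pair_square_decomp HT by blast
      have ss: "s \<circ> s \<in> perm_gen (H \<union> Sq)" "s \<circ> s \<in> perm_gen (?R \<union> Sq)"
        using s unfolding Sq_def by (blast intro: perm_gen.gen_base)+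
      have "bij (s \<circ> s)" using perm_gen_bij[of "{u, v}"] bu bv s bij_comp by blast
      have "h \<circ> inv_into UNIV (s \<circ> s) = r \<circ> ((s \<circ> s) \<circ> inv_into UNIV (s \<circ> s))"
        unfolding hrs by (simp only: comp_assoc)
      also have "\<dots> = r"
        using surj_iff[THEN iffD1, OF bij_is_surj[OF \<open>bij (s \<circ> s)\<close>]] by simp
      finally have r_eq: "r = h \<circ> inv_into UNIV (s \<circ> s)" ..
      have "h \<in> perm_gen (H \<union> Sq)" using True by (simp add: perm_gen.gen_base)
      then have "r \<in> perm_gen (H \<union> Sq)"
        unfolding r_eq by (rule perm_gen.gen_comp[OF _ perm_gen.gen_inv[OF ss(1)]])
      then have "r = id \<or> r \<in> ?R" using r by blast
      then have "r \<in> perm_gen (?R \<union> Sq)" by (auto intro: perm_gen.gen_id perm_gen.gen_base)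
      then show ?thesis unfolding hrs using ss(2) by (rule perm_gen.gen_comp)
    next
      case False
      with h show ?thesis by (blast intro: perm_gen.gen_base)
    qed
  qed
qed

theorem even_card_gen_orbits_subgroup:
  assumes eu: "evenperm u" and ev: "evenperm v"
    and eT: "even (CARD('a) + card (gen_orbits {u, v}))"
    and H: "is_subgroup H (perm_gen {u, v})"
  shows "even (CARD('a) + card (gen_orbits H))"
proof -
  define T where "T = perm_gen {u, v}"
  define Sq where "Sq = (\<lambda>t. t \<circ> t) ` T"
  define R where "R = perm_gen (H \<union> Sq) \<inter> {u, v, u \<circ> v}"
  have Tb: "\<forall>t\<in>T. bij t" unfolding T_def using perm_gen_bij[of "{u, v}"] bu bv by blast
  have Tc: "\<forall>a\<in>T. \<forall>b\<in>T. a \<circ> b = b \<circ> a"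
    unfolding T_def using perm_gen_commutative[of "{u, v}"] bu bv uv by auto
  have Tsq: "\<forall>t\<in>T. t \<circ> t \<in> T" unfolding T_def using perm_gen.gen_comp by blast
  have HT: "H \<subseteq> T" using H unfolding is_subgroup_def T_def by blast
  have "u \<circ> v \<in> T" unfolding T_def by (rule perm_gen.gen_comp; rule perm_gen.gen_base; simp)
  then have RT: "R \<subseteq> T" unfolding R_def T_def by (blast intro: perm_gen.gen_base)
  have "gen_orbits (H \<union> Sq) = gen_orbits (R \<union> Sq)"
    using perm_gen_Un_squares_eq[OF HT[unfolded T_def]] unfolding R_def Sq_def T_def
    by (rule gen_orbits_cong)
  moreover have "even (card (gen_orbits H) + card (gen_orbits (H \<union> Sq)))"
    unfolding Sq_def by (rule even_card_gen_orbits_Un_squares[OF Tb Tc Tsq HT])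
  ultimately have "even (card (gen_orbits H) + card (gen_orbits (R \<union> Sq)))" by simp
  moreover have "even (card (gen_orbits R) + card (gen_orbits (R \<union> Sq)))"
    unfolding Sq_def by (rule even_card_gen_orbits_Un_squares[OF Tb Tc Tsq RT])
  moreover have "even (CARD('a) + card (gen_orbits R))"
    by (rule even_card_gen_orbits_subset_triple[OF eu ev eT]) (simp add: R_def)
  ultimately show ?thesis by presburger
qed

end

section \<open>Determinant of a linear map restricted to an invariant subspace\<close>

definition fn_mat :: "nat \<Rightarrow> (nat \<Rightarrow> nat \<Rightarrow> 'a) \<Rightarrow> 'a Matrix.mat" where
  "fn_mat k B = Matrix.mat k k (\<lambda>(i, j). B i j)"

lemma fn_mat_carrier [simp]: "fn_mat k B \<in> carrier_mat k k"
  unfolding fn_mat_def by simp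

lemma fn_mat_dims [simp]: "dim_row (fn_mat k B) = k" "dim_col (fn_mat k B) = k"
  unfolding fn_mat_def by simp_all

lemma det_fn_eq_det: "det_fn k B = Determinant.det (fn_mat k B)"
proof -
  have "Determinant.det (fn_mat k B)
      = (\<Sum>p | p permutes {0..<k}. of_int (sign p) * (\<Prod>i = 0..<k. fn_mat k B $$ (i, p i)))"
    unfolding Determinant.det_def fn_mat_def by simp
  also have "\<dots> = (\<Sum>p | p permutes {..<k}. of_int (sign p) * (\<Prod>i<k. B i (p i)))"
  proof (rule sum.cong)
    fix p assume "p \<in> {p. p permutes {..<k}}"
    then have p: "p permutes {..<k}" by simp
    have "(\<Prod>i = 0..<k. fn_mat k B $$ (i, p i)) = (\<Prod>i<k. B i (p i))"
      unfolding lessThan_atLeast0[symmetric]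
      by (rule prod.cong) (use p permutes_in_image[OF p] in \<open>auto simp: fn_mat_def\<close>)
    then show "of_int (sign p) * (\<Prod>i = 0..<k. fn_mat k B $$ (i, p i))
        = of_int (sign p) * (\<Prod>i<k. B i (p i))" by simp
  qed (simp add: lessThan_atLeast0)
  finally show ?thesis unfolding det_fn_def by simp
qed

lemma fn_mat_mult: "fn_mat k P * fn_mat k Q = fn_mat k (\<lambda>i j. \<Sum>l<k. P i l * Q l j)"
  by (rule eq_matI) (auto simp: fn_mat_def scalar_prod_def lessThan_atLeast0)

lemma fn_mat_eq_one:
  "(\<And>i j. i < k \<Longrightarrow> j < k \<Longrightarrow> P i j = (if i = j then 1 else 0)) \<Longrightarrow> fn_mat k P = 1\<^sub>m k"
  by (rule eq_matI) (auto simp: fn_mat_def)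

lemma fn_mat_cong: "(\<And>i j. i < k \<Longrightarrow> j < k \<Longrightarrow> P i j = Q i j) \<Longrightarrow> fn_mat k P = fn_mat k Q"
  by (rule eq_matI) (auto simp: fn_mat_def)

lemma sum_delta_scale:
  assumes "j < (k::nat)" shows "(\<Sum>l<k. (if l = j then 1 else 0) *s b l) = (b j :: 'a::field ^ 'n)"
proof -
  have "(\<Sum>l<k. (if l = j then 1 else 0) *s b l) = (\<Sum>l<k. if l = j then b l else 0)"
    by (rule sum.cong) auto
  also have "\<dots> = b j" using assms by (simp add: sum.delta sum.delta')
  finally show ?thesis .
qed

lemma sum_scale_sum_swap:
  "(\<Sum>i<(k::nat). c i *s (\<Sum>l<k. P l i *s b l))
    = (\<Sum>l<k. (\<Sum>i<k. P l i * c i) *s (b l :: 'a::field ^ 'n))"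
proof -
  have "(\<Sum>i<k. c i *s (\<Sum>l<k. P l i *s b l)) = (\<Sum>i<k. \<Sum>l<k. (P l i * c i) *s b l)"
    by (rule sum.cong) (auto simp: vec.scale_sum_right vector_smult_assoc mult.commute)
  also have "\<dots> = (\<Sum>l<k. \<Sum>i<k. (P l i * c i) *s b l)" by (rule sum.swap)
  also have "\<dots> = (\<Sum>l<k. (\<Sum>i<k. P l i * c i) *s b l)"
    by (rule sum.cong) (auto simp: vec.scale_sum_left)
  finally show ?thesis .
qed

lemma sum_scale_in_span: "(\<Sum>i<k. c i *s b i) \<in> vec.span (b ` {..<k})"
  by (intro vec.span_sum vec.span_scale vec.span_base) auto

lemma is_cbasis_mem:
  assumes "is_cbasis S k b" "i < k" shows "b i \<in> S"
proof -
  have "b i \<in> vec.span (b ` {..<k})" using assms(2) by (intro vec.span_base) auto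
  then show ?thesis using assms(1) unfolding is_cbasis_def by simp
qed

lemma is_cbasis_dim:
  assumes "is_cbasis S k b" shows "vec.dim S = k"
proof -
  have b: "inj_on b {..<k}" "vec.independent (b ` {..<k})" "vec.span (b ` {..<k}) = S"
    using assms unfolding is_cbasis_def by auto
  have "vec.dim S = card (b ` {..<k})"
    unfolding b(3)[symmetric] by (rule vec.dim_span_eq_card_independent[OF b(2)])
  also have "\<dots> = k" using card_image[OF b(1)] by simp
  finally show ?thesis .
qed

lemma is_cbasisI:
  fixes b :: "nat \<Rightarrow> complex ^ 'n"
  assumes indep: "\<And>c. (\<Sum>i<k. c i *s b i) = 0 \<Longrightarrow> \<forall>i<k. c i = 0"
    and span: "vec.span (b ` {..<k}) = S"
  shows "is_cbasis S k b"
proof -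
  have inj: "inj_on b {..<k}"
  proof (rule inj_onI, rule ccontr)
    fix i j assume i: "i \<in> {..<k}" and j: "j \<in> {..<k}" and eq: "b i = b j" and "i \<noteq> j"
    define c where "c = (\<lambda>l. (if l = i then 1 else 0) - (if l = j then (1::complex) else 0))"
    have "(\<Sum>l<k. c l *s b l)
        = (\<Sum>l<k. (if l = i then 1 else 0) *s b l) - (\<Sum>l<k. (if l = j then 1 else 0) *s b l)"
      unfolding c_def by (simp add: vector_sub_rdistrib sum_subtractf)
    also have "\<dots> = 0" using sum_delta_scale[of i k b] sum_delta_scale[of j k b] i j eq by simp
    finally have "c i = 0" using indep i by blast
    with \<open>i \<noteq> j\<close> show False unfolding c_def by simp
  qed
  have "\<not> vec.dependent (b ` {..<k})"
  proof
    assume "vec.dependent (b ` {..<k})"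
    then obtain u where u: "\<exists>v\<in>b ` {..<k}. u v \<noteq> 0" "(\<Sum>v\<in>b ` {..<k}. u v *s v) = 0"
      using vec.dependent_finite[of "b ` {..<k}"] by auto
    have "(\<Sum>i<k. u (b i) *s b i) = 0" using u(2) sum.reindex[OF inj, of "\<lambda>v. u v *s v"] by simp
    then have "\<forall>i<k. u (b i) = 0" by (rule indep)
    with u(1) show False by auto
  qed
  with inj span show ?thesis unfolding is_cbasis_def by simp
qed

lemma is_cbasis_coords_unique:
  assumes "is_cbasis S k b" "(\<Sum>i<k. c i *s b i) = (\<Sum>i<k. d i *s b i)" "i < k"
  shows "c i = d i"
proof -
  let ?X = "b ` {..<k}"
  have inj: "inj_on b {..<k}" and indep: "vec.independent ?X"
    using assms(1) unfolding is_cbasis_def by auto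
  define u where "u = (\<lambda>x. c (the_inv_into {..<k} b x) - d (the_inv_into {..<k} b x))"
  have "(\<Sum>x\<in>?X. u x *s x) = (\<Sum>i<k. u (b i) *s b i)"
    by (rule sum.reindex[OF inj, unfolded o_def])
  also have "\<dots> = (\<Sum>i<k. c i *s b i) - (\<Sum>i<k. d i *s b i)"
    by (simp add: u_def the_inv_into_f_f[OF inj] vector_sub_rdistrib sum_subtractf)
  also have "\<dots> = 0" using assms(2) by simp
  finally have "\<forall>x\<in>?X. u x = 0" using indep vec.dependent_finite[of ?X] by auto
  then show ?thesis unfolding u_def using the_inv_into_f_f[OF inj] assms(3) by fastforce
qed

lemma is_cbasis_coords:
  assumes "is_cbasis S k b" "x \<in> S"
  obtains c where "x = (\<Sum>i<k. c i *s b i)"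
proof -
  have inj: "inj_on b {..<k}" and "x \<in> vec.span (b ` {..<k})"
    using assms unfolding is_cbasis_def by auto
  then obtain u where "x = (\<Sum>v\<in>b ` {..<k}. u v *s v)" using vec.span_finite[of "b ` {..<k}"] by auto
  also have "\<dots> = (\<Sum>i<k. u (b i) *s b i)" by (rule sum.reindex[OF inj, unfolded o_def])
  finally show ?thesis by (rule that)
qed

lemma is_cbasis_coords_fun:
  assumes "is_cbasis S k b" "\<And>j. j < k' \<Longrightarrow> f j \<in> S"
  obtains P where "\<forall>j<k'. f j = (\<Sum>i<k. P i j *s b i)"
proof -
  have "\<forall>j. \<exists>c. j < k' \<longrightarrow> f j = (\<Sum>i<k. c i *s b i)"
    using is_cbasis_coords[OF assms(1) assms(2)] by blast
  then obtain C where "\<forall>j. j < k' \<longrightarrow> f j = (\<Sum>i<k. C j i *s b i)" by (metis choice)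
  then show ?thesis by (intro that[of "\<lambda>i j. C j i"]) auto
qed

definition is_matrix_on ::
  "complex^'n^'n \<Rightarrow> (complex^'n) set \<Rightarrow> nat \<Rightarrow> (nat \<Rightarrow> complex^'n) \<Rightarrow> (nat \<Rightarrow> nat \<Rightarrow> complex) \<Rightarrow> bool"
  where "is_matrix_on A S k b B \<longleftrightarrow> is_cbasis S k b \<and> (\<forall>j<k. A *v b j = (\<Sum>i<k. B i j *s b i))"

lemma change_of_basis_inverse:
  assumes b: "is_cbasis S k b"
    and P: "\<forall>j<k. b' j = (\<Sum>i<k. P i j *s b i)" and Q: "\<forall>j<k. b j = (\<Sum>i<k. Q i j *s b' i)"
  shows "fn_mat k P * fn_mat k Q = 1\<^sub>m k"
proof -
  have "(\<Sum>i<k. P l i * Q i j) = (if l = j then 1 else 0)" if l: "l < k" and j: "j < k" for l j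
  proof -
    have "(\<Sum>l<k. (\<Sum>i<k. P l i * Q i j) *s b l) = (\<Sum>i<k. Q i j *s (\<Sum>l<k. P l i *s b l))"
      by (rule sum_scale_sum_swap[symmetric])
    also have "\<dots> = (\<Sum>i<k. Q i j *s b' i)" using P by (intro sum.cong) auto
    also have "\<dots> = (\<Sum>l<k. (if l = j then 1 else 0) *s b l)" using Q j sum_delta_scale[OF j, of b]
      by simp
    finally show ?thesis by (rule is_cbasis_coords_unique[OF b _ l])
  qed
  then show ?thesis unfolding fn_mat_mult by (intro fn_mat_eq_one) auto
qed

lemma det_fn_basis_independent:
  assumes "is_matrix_on A S k b B" "is_matrix_on A S k' b' B'"
  shows "det_fn k B = det_fn k' B'"
proof -
  have b: "is_cbasis S k b" and b'0: "is_cbasis S k' b'" using assms unfolding is_matrix_on_def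
    by auto
  have kk: "k' = k" using is_cbasis_dim[OF b] is_cbasis_dim[OF b'0] by simp
  have b': "is_cbasis S k b'" using b'0 kk by simp
  have AB: "\<forall>j<k. A *v b j = (\<Sum>i<k. B i j *s b i)"
    and AB': "\<forall>j<k. A *v b' j = (\<Sum>i<k. B' i j *s b' i)"
    using assms kk unfolding is_matrix_on_def by auto
  obtain P where P: "\<forall>j<k. b' j = (\<Sum>i<k. P i j *s b i)"
    using is_cbasis_coords_fun[OF b, of k b'] is_cbasis_mem[OF b'] by blast
  obtain Q where Q: "\<forall>j<k. b j = (\<Sum>i<k. Q i j *s b' i)"
    using is_cbasis_coords_fun[OF b', of k b] is_cbasis_mem[OF b] by blast
  have PQ: "fn_mat k P * fn_mat k Q = 1\<^sub>m k" by (rule change_of_basis_inverse[OF b P Q])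
  have QP: "fn_mat k Q * fn_mat k P = 1\<^sub>m k" by (rule change_of_basis_inverse[OF b' Q P])
  have "(\<Sum>i<k. B l i * P i j) = (\<Sum>m<k. P l m * B' m j)" if l: "l < k" and j: "j < k" for l j
  proof -
    have "(\<Sum>l<k. (\<Sum>i<k. B l i * P i j) *s b l) = (\<Sum>i<k. P i j *s (\<Sum>l<k. B l i *s b l))"
      by (rule sum_scale_sum_swap[symmetric])
    also have "\<dots> = (\<Sum>i<k. P i j *s (A *v b i))" using AB by (intro sum.cong) auto
    also have "\<dots> = A *v b' j" using P j by (simp add: vec.sum vector_scalar_commute)
    also have "\<dots> = (\<Sum>m<k. B' m j *s (\<Sum>l<k. P l m *s b l))" using AB' P j by (auto intro: sum.cong)
    also have "\<dots> = (\<Sum>l<k. (\<Sum>m<k. P l m * B' m j) *s b l)" by (rule sum_scale_sum_swap)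
    finally show ?thesis by (rule is_cbasis_coords_unique[OF b _ l])
  qed
  then have BP: "fn_mat k B * fn_mat k P = fn_mat k P * fn_mat k B'"
    unfolding fn_mat_mult by (intro fn_mat_cong) auto
  have "fn_mat k B' = (fn_mat k Q * fn_mat k P) * fn_mat k B'"
    using QP by simp
  also have "\<dots> = fn_mat k Q * (fn_mat k P * fn_mat k B')" by (rule assoc_mult_mat) auto
  also have "\<dots> = fn_mat k Q * (fn_mat k B * fn_mat k P)" using BP by simp
  also have "\<dots> = fn_mat k Q * fn_mat k B * fn_mat k P" by (rule assoc_mult_mat[symmetric]) auto
  finally have "fn_mat k B' = fn_mat k Q * fn_mat k B * fn_mat k P" .
  then have "similar_mat (fn_mat k B') (fn_mat k B)"
    by (intro similar_matI[OF _ QP PQ]) auto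
  then have "Determinant.det (fn_mat k B') = Determinant.det (fn_mat k B)" by (rule det_similar)
  then show ?thesis using kk by (simp add: det_fn_eq_det)
qed

lemma det_on_eq_det_fn:
  assumes "is_matrix_on A S k b B" shows "det_on A S = det_fn k B"
proof -
  have "\<exists>k' b' B'. is_cbasis S k' b' \<and> (\<forall>j<k'. A *v b' j = (\<Sum>i<k'. B' i j *s b' i))
      \<and> det_on A S = det_fn k' B'"
    unfolding det_on_def by (rule someI_ex) (use assms in \<open>auto simp: is_matrix_on_def\<close>)
  then obtain k' b' B' where "is_matrix_on A S k' b' B'" "det_on A S = det_fn k' B'"
    unfolding is_matrix_on_def by blast
  then show ?thesis using det_fn_basis_independent[OF assms] by simp
qed

lemma is_matrix_on_exists:
  assumes S: "vec.subspace S" and invariant: "\<forall>x\<in>S. A *v x \<in> S"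
  obtains k b B where "is_matrix_on A S k b B"
proof -
  obtain Bs where Bs: "Bs \<subseteq> S" "vec.independent Bs" "S \<subseteq> vec.span Bs"
    using vec.maximal_independent_subset[of S] by blast
  have fin: "finite Bs" using vec.finiteI_independent[OF Bs(2)] .
  obtain b where "bij_betw b {0..<card Bs} Bs" using ex_bij_betw_nat_finite[OF fin] by blast
  then have hb: "bij_betw b {..<card Bs} Bs" by (simp add: lessThan_atLeast0)
  have cb: "is_cbasis S (card Bs) b"
    unfolding is_cbasis_def using bij_betw_imp_inj_on[OF hb] bij_betw_imp_surj_on[OF hb] Bs
      vec.span_subspace[OF Bs(1) Bs(3) S] by simp
  obtain B where "\<forall>j<card Bs. A *v b j = (\<Sum>i<card Bs. B i j *s b i)"
    using is_cbasis_coords_fun[OF cb, of "card Bs" "\<lambda>j. A *v b j"] invariant is_cbasis_mem[OF cb]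
    by blast
  with cb have "is_matrix_on A S (card Bs) b B" unfolding is_matrix_on_def by blast
  then show ?thesis by (rule that)
qed

lemma sum_lessThan_add_split:
  "(\<Sum>i<k1 + k2. f i) = (\<Sum>i<k1. f i) + (\<Sum>i<k2. f (k1 + i :: nat))"
  by (induction k2) (simp_all add: add.assoc)

definition basis_append :: "nat \<Rightarrow> (nat \<Rightarrow> 'a) \<Rightarrow> (nat \<Rightarrow> 'a) \<Rightarrow> nat \<Rightarrow> 'a" where
  "basis_append k1 b1 b2 = (\<lambda>i. if i < k1 then b1 i else b2 (i - k1))"

definition block_diag ::
  "nat \<Rightarrow> (nat \<Rightarrow> nat \<Rightarrow> complex) \<Rightarrow> (nat \<Rightarrow> nat \<Rightarrow> complex) \<Rightarrow> nat \<Rightarrow> nat \<Rightarrow> complex" where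
  "block_diag k1 B1 B2 = (\<lambda>i j. if i < k1 then (if j < k1 then B1 i j else 0)
      else (if j < k1 then 0 else B2 (i - k1) (j - k1)))"

lemma sum_basis_append:
  "(\<Sum>i<k1 + k2. c i *s basis_append k1 b1 b2 i)
    = (\<Sum>i<k1. c i *s b1 i) + (\<Sum>i<k2. c (k1 + i) *s b2 i)"
  unfolding sum_lessThan_add_split basis_append_def by simp

lemma det_fn_block_diag: "det_fn (k1 + k2) (block_diag k1 B1 B2) = det_fn k1 B1 * det_fn k2 B2"
proof -
  have "fn_mat (k1 + k2) (block_diag k1 B1 B2)
      = four_block_mat (fn_mat k1 B1) (0\<^sub>m k1 k2) (0\<^sub>m k2 k1) (fn_mat k2 B2)"
    by (rule eq_matI) (auto simp: block_diag_def fn_mat_def)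
  moreover have
    "Determinant.det (four_block_mat (fn_mat k1 B1) (0\<^sub>m k1 k2) (0\<^sub>m k2 k1) (fn_mat k2 B2))
      = Determinant.det (fn_mat k1 B1) * Determinant.det (fn_mat k2 B2)"
    by (rule det_four_block_mat_upper_right_zero) auto
  ultimately show ?thesis by (simp add: det_fn_eq_det)
qed

context
  fixes S1 S2 :: "(complex^'n) set"
  assumes S2: "vec.subspace S2"
    and inter: "\<And>x. x \<in> S1 \<Longrightarrow> x \<in> S2 \<Longrightarrow> x = 0"
    and decomp: "\<And>x. \<exists>x1\<in>S1. \<exists>x2\<in>S2. x = x1 + x2"
begin

lemma is_cbasis_append:
  assumes b1: "is_cbasis S1 k1 b1" and b2: "is_cbasis S2 k2 b2"
  shows "is_cbasis UNIV (k1 + k2) (basis_append k1 b1 b2)"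
proof (rule is_cbasisI)
  have span1: "vec.span (b1 ` {..<k1}) = S1" and span2: "vec.span (b2 ` {..<k2}) = S2"
    using b1 b2 unfolding is_cbasis_def by auto
  fix c assume "(\<Sum>i<k1 + k2. c i *s basis_append k1 b1 b2 i) = 0"
  then have z: "(\<Sum>i<k1. c i *s b1 i) = - (\<Sum>i<k2. c (k1 + i) *s b2 i)"
    unfolding sum_basis_append by (simp add: eq_neg_iff_add_eq_0)
  have "(\<Sum>i<k2. c (k1 + i) *s b2 i) \<in> S2"
    using sum_scale_in_span[where c = "\<lambda>i. c (k1 + i)" and k = k2 and b = b2] span2 by simp
  then have "(\<Sum>i<k1. c i *s b1 i) \<in> S2" unfolding z by (rule vec.subspace_neg[OF S2])
  moreover have "(\<Sum>i<k1. c i *s b1 i) \<in> S1"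
    using sum_scale_in_span[where c = c and k = k1 and b = b1] span1 by simp
  ultimately have z1: "(\<Sum>i<k1. c i *s b1 i) = (\<Sum>i<k1. 0 *s b1 i)" using inter by simp
  then have z2: "(\<Sum>i<k2. c (k1 + i) *s b2 i) = (\<Sum>i<k2. 0 *s b2 i)" using z by simp
  have "c i = 0" if "i < k1" for i using is_cbasis_coords_unique[OF b1 z1 that] by simp
  moreover have "c (k1 + i) = 0" if "i < k2" for i using is_cbasis_coords_unique[OF b2 z2 that]
    by simp
  ultimately show "\<forall>i<k1 + k2. c i = 0" by (metis add_diff_inverse_nat add_less_cancel_left)
next
  have span1: "vec.span (b1 ` {..<k1}) = S1" and span2: "vec.span (b2 ` {..<k2}) = S2"
    using b1 b2 unfolding is_cbasis_def by auto
  let ?B = "basis_append k1 b1 b2 ` {..<k1 + k2}"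
  have "b1 ` {..<k1} \<subseteq> ?B"
    by (auto simp: basis_append_def intro!: image_eqI)
  moreover have "b2 i \<in> ?B" if "i < k2" for i
    using that by (intro image_eqI[of _ _ "k1 + i"]) (auto simp: basis_append_def)
  then have "b2 ` {..<k2} \<subseteq> ?B" by blast
  ultimately have "S1 \<subseteq> vec.span ?B" "S2 \<subseteq> vec.span ?B"
    using span1 span2 vec.span_mono by blast+
  then have "x \<in> vec.span ?B" for x using decomp[of x] vec.span_add by blast
  then show "vec.span ?B = UNIV" by blast
qed

lemma is_matrix_on_direct_sum:
  assumes r1: "is_matrix_on A S1 k1 b1 B1" and r2: "is_matrix_on A S2 k2 b2 B2"
  shows "is_matrix_on A UNIV (k1 + k2) (basis_append k1 b1 b2) (block_diag k1 B1 B2)"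
  unfolding is_matrix_on_def
proof (intro conjI allI impI)
  show "is_cbasis UNIV (k1 + k2) (basis_append k1 b1 b2)"
    using is_cbasis_append r1 r2 unfolding is_matrix_on_def by blast
  fix j assume j: "j < k1 + k2"
  show "A *v basis_append k1 b1 b2 j
      = (\<Sum>i<k1 + k2. block_diag k1 B1 B2 i j *s basis_append k1 b1 b2 i)"
  proof (cases "j < k1")
    case True
    with r1 show ?thesis
      unfolding sum_basis_append is_matrix_on_def by (simp add: basis_append_def block_diag_def)
  next
    case False
    then obtain j' where j': "j' < k2" "j = k1 + j'" using j
      by (metis add_less_imp_less_left le_Suc_ex not_le)
    with r2 show ?thesis
      unfolding sum_basis_append is_matrix_on_def by (simp add: basis_append_def block_diag_def)
  qed
qed

lemma det_on_direct_sum: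
  assumes S1: "vec.subspace S1" and invariant: "\<forall>x\<in>S1. A *v x \<in> S1" "\<forall>x\<in>S2. A *v x \<in> S2"
  shows "det_on A UNIV = det_on A S1 * det_on A S2"
proof -
  obtain k1 b1 B1 where r1: "is_matrix_on A S1 k1 b1 B1"
    using is_matrix_on_exists[OF S1 invariant(1)] .
  obtain k2 b2 B2 where r2: "is_matrix_on A S2 k2 b2 B2"
    using is_matrix_on_exists[OF S2 invariant(2)] .
  show ?thesis
    using det_on_eq_det_fn[OF is_matrix_on_direct_sum[OF r1 r2]] det_fn_block_diag
      det_on_eq_det_fn[OF r1] det_on_eq_det_fn[OF r2] by simp
qed

end

lemma det_fn_perm_matrix:
  assumes s: "\<sigma> permutes {..<k}"
  shows "det_fn k (\<lambda>i j. if i = \<sigma> j then 1 else 0) = of_int (sign \<sigma>)"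
proof -
  have si: "inv_into UNIV \<sigma> permutes {..<k}" using permutes_inv[OF s] .
  have "of_int (sign p) * (\<Prod>i<k. (if i = \<sigma> (p i) then 1 else 0))
      = (if p = inv_into UNIV \<sigma> then of_int (sign p) else (0::complex))"
    if p: "p permutes {..<k}" for p
  proof (cases "p = inv_into UNIV \<sigma>")
    case True
    then show ?thesis using permutes_inverses(1)[OF s] by simp
  next
    case False
    have "\<exists>i<k. i \<noteq> \<sigma> (p i)"
    proof (rule ccontr)
      assume "\<not> (\<exists>i<k. i \<noteq> \<sigma> (p i))"
      then have "p i = inv_into UNIV \<sigma> i" for i
        using permutes_inverses(2)[OF s] permutes_not_in[OF p] permutes_not_in[OF si]
        by (cases "i < k") (metis, simp)
      with False show False by blast
    qed
    then have "(\<Prod>i<k. (if i = \<sigma> (p i) then 1 else 0)) = (0::complex)"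
      by (intro prod_zero) auto
    with False show ?thesis by simp
  qed
  then have "det_fn k (\<lambda>i j. if i = \<sigma> j then 1 else 0)
      = (\<Sum>p | p permutes {..<k}. if p = inv_into UNIV \<sigma> then of_int (sign p) else 0)"
    unfolding det_fn_def by (intro sum.cong) auto
  also have "\<dots> = of_int (sign (inv_into UNIV \<sigma>))"
    using si by (simp add: sum.delta' finite_permutations)
  also have "\<dots> = of_int (sign \<sigma>)"
    using sign_inverse[OF permutes_imp_permutation[OF _ s]] by simp
  finally show ?thesis .
qed

lemma det_on_permuting_basis:
  assumes e: "bij_betw e {..<k} X" and b: "is_cbasis S k (f \<circ> e)"
    and \<pi>: "\<pi> permutes X" and A: "\<forall>x\<in>X. A *v f x = f (\<pi> x)"
  shows "det_on A S = of_int (sign \<pi>)"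
proof -
  define e' where "e' = inv_into {..<k} e"
  have e': "bij_betw e' X {..<k}" unfolding e'_def by (rule bij_betw_inv_into[OF e])
  have finX: "finite X" using bij_betw_finite[OF e] by simp
  define \<sigma> where "\<sigma> = map_permutation X e' \<pi>"
  have \<sigma>: "\<sigma> permutes {..<k}" unfolding \<sigma>_def by (rule map_permutation_permutes[OF e' \<pi>])
  have "sign \<sigma> = sign \<pi>"
    unfolding \<sigma>_def by (rule sign_map_permutation[OF bij_betw_imp_inj_on[OF e'] \<pi> finX])
  have "A *v (f \<circ> e) j = (\<Sum>i<k. (if i = \<sigma> j then 1 else 0) *s (f \<circ> e) i)" if j: "j < k" for j
  proof -
    have ej: "e j \<in> X" and e'e: "e' (e j) = j"
      using j bij_betw_apply[OF e] bij_betw_inv_into_left[OF e] unfolding e'_def by auto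
    have "\<sigma> j = e' (\<pi> (e j))"
      using map_permutation_apply[OF bij_betw_imp_inj_on[OF e'] ej, of \<pi>] e'e unfolding \<sigma>_def
      by simp
    then have "e (\<sigma> j) = \<pi> (e j)"
      using bij_betw_inv_into_right[OF e] permutes_in_image[OF \<pi>] ej unfolding e'_def by simp
    moreover have "\<sigma> j < k" using permutes_in_image[OF \<sigma>] j by simp
    ultimately show ?thesis using A ej sum_delta_scale[of "\<sigma> j" k "f \<circ> e"] by simp
  qed
  with b have "is_matrix_on A S k (f \<circ> e) (\<lambda>i j. if i = \<sigma> j then 1 else 0)"
    unfolding is_matrix_on_def by blast
  then show ?thesis
    using det_fn_perm_matrix[OF \<sigma>] \<open>sign \<sigma> = sign \<pi>\<close> by (simp add: det_on_eq_det_fn)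
qed

section \<open>Permutation matrices and their invariant vectors\<close>

lemma perm_mat_mult_vec:
  assumes p: "p permutes UNIV"
  shows "perm_mat p *v x = (\<chi> i. x $ inv_into UNIV p i)"
proof -
  have "(perm_mat p *v x) $ i = x $ inv_into UNIV p i" for i
  proof -
    have "(perm_mat p *v x) $ i = (\<Sum>j\<in>UNIV. (if i = p j then 1 else 0) * x $ j)"
      unfolding perm_mat_def matrix_vector_mult_def by simp
    also have "\<dots> = (\<Sum>j\<in>UNIV. if j = inv_into UNIV p i then x $ j else 0)"
    proof (rule sum.cong)
      fix j show "(if i = p j then 1 else 0) * x $ j = (if j = inv_into UNIV p i then x $ j else 0)"
        using permutes_inv_eq[OF p, of i j] by auto
    qed simp
    also have "\<dots> = x $ inv_into UNIV p i" by (simp add: sum.delta')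
    finally show ?thesis .
  qed
  then show ?thesis by (simp add: Finite_Cartesian_Product.vec_eq_iff)
qed

lemma perm_mat_comp:
  assumes p: "p permutes UNIV" and q: "q permutes UNIV"
  shows "perm_mat p *v (perm_mat q *v x) = perm_mat (p \<circ> q) *v x"
proof -
  have "inv_into UNIV (p \<circ> q) = inv_into UNIV q \<circ> inv_into UNIV p"
    using o_inv_distrib[OF permutes_bij[OF p] permutes_bij[OF q]] .
  then show ?thesis
    unfolding perm_mat_mult_vec[OF p] perm_mat_mult_vec[OF q]
      perm_mat_mult_vec[OF permutes_compose[OF q p]]
    by simp
qed

lemma perm_mat_funpow:
  assumes p: "p permutes UNIV"
  shows "((*v) (perm_mat p) ^^ n) x = perm_mat (p ^^ n) *v x"
proof (induction n)
  case 0
  have "perm_mat id *v x = x"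
    using perm_mat_mult_vec[OF permutes_id] by (simp add: Finite_Cartesian_Product.vec_eq_iff)
  then show ?case by (metis funpow.simps(1) id_apply)
next
  case (Suc n)
  then have "((*v) (perm_mat p) ^^ Suc n) x = perm_mat p *v (perm_mat (p ^^ n) *v x)" by simp
  also have "\<dots> = perm_mat (p ^^ Suc n) *v x"
    unfolding perm_mat_comp[OF p permutes_funpow[OF p]] by (simp only: funpow.simps(2))
  finally show ?case .
qed

definition indicator_vec :: "'n set \<Rightarrow> complex ^ 'n" where
  "indicator_vec X = (\<chi> i. if i \<in> X then 1 else 0)"

lemma perm_mat_indicator_vec:
  assumes p: "p permutes UNIV"
  shows "perm_mat p *v indicator_vec X = indicator_vec (p ` X)"
proof -
  have "inv_into UNIV p i \<in> X \<longleftrightarrow> i \<in> p ` X" for i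
    using permutes_inverses[OF p] by (metis image_iff)
  then show ?thesis unfolding perm_mat_mult_vec[OF p] indicator_vec_def
    by (simp add: Finite_Cartesian_Product.vec_eq_iff)
qed

lemma mem_fixed_space_iff:
  fixes G :: "('n::finite \<Rightarrow> 'n) set"
  assumes G: "\<forall>g\<in>G. g permutes UNIV"
  shows "x \<in> fixed_space G \<longleftrightarrow> (\<forall>h\<in>perm_gen G. \<forall>i. x $ h i = x $ i)"
proof -
  have "perm_mat g *v x = x \<longleftrightarrow> (\<forall>i. x $ inv_into UNIV g i = x $ i)" if "g \<in> G" for g
    using perm_mat_mult_vec[of g x] G that by (simp add: Finite_Cartesian_Product.vec_eq_iff)
  then have "x \<in> fixed_space G \<longleftrightarrow> (\<forall>g\<in>G. \<forall>i. x $ inv_into UNIV g i = x $ i)"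
    unfolding fixed_space_def by simp
  also have "\<dots> \<longleftrightarrow> (\<forall>g\<in>G. \<forall>i. x $ g i = x $ i)"
    using G by (metis permutes_inverses)
  also have "\<dots> \<longleftrightarrow> (\<forall>h\<in>perm_gen G. \<forall>i. x $ h i = x $ i)"
  proof
    assume x: "\<forall>g\<in>G. \<forall>i. x $ g i = x $ i"
    have "x $ h i = x $ i" if "h \<in> perm_gen G" for h i
      using that
    proof (induction arbitrary: i)
      case (gen_inv g)
      have "bij g" using perm_gen_bij[OF _ gen_inv(1)] G permutes_bij by blast
      then show ?case using gen_inv(2)[of "inv_into UNIV g i"]
        by (simp add: bij_is_surj surj_f_inv_f)
    qed (use x in auto)
    then show "\<forall>h\<in>perm_gen G. \<forall>i. x $ h i = x $ i" by blast
  qed (blast intro: perm_gen.gen_base)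
  finally show ?thesis .
qed

lemma subspace_fixed_space: "vec.subspace (fixed_space G)"
  unfolding fixed_space_def vec.subspace_def
  by (simp add: matrix_vector_right_distrib vector_scalar_commute)

lemma indicator_vec_mem_fixed_space:
  fixes G :: "('n::finite \<Rightarrow> 'n) set"
  assumes G: "\<forall>g\<in>G. g permutes UNIV" and X: "X \<in> gen_orbits G"
  shows "indicator_vec X \<in> fixed_space G"
proof -
  have Gb: "\<forall>g\<in>G. bij g" using G permutes_bij by blast
  obtain a where a: "X = gen_orbit G a" using X unfolding gen_orbits_def by blast
  have "h i \<in> X \<longleftrightarrow> i \<in> X" if "h \<in> perm_gen G" for h i
  proof -
    have "gen_orbit G (h i) = gen_orbit G i"
      using gen_orbit_eq_iff[OF Gb, of i "h i"] that unfolding gen_orbit_def by auto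
    then show ?thesis unfolding a using gen_orbit_eq_iff[OF Gb, of a] by metis
  qed
  then show ?thesis unfolding mem_fixed_space_iff[OF G] indicator_vec_def by simp
qed

lemma sum_indicator_vec_gen_orbits_nth:
  fixes G :: "('n::finite \<Rightarrow> 'n) set" and K :: nat
  assumes G: "\<forall>g\<in>G. bij g" and e: "bij_betw e {..<K} (gen_orbits G)"
  shows "(\<Sum>i<K. c i *s indicator_vec (e i)) $ y = c (inv_into {..<K} e (gen_orbit G y))"
proof -
  define j where "j = inv_into {..<K} e (gen_orbit G y)"
  have j: "j < K" "e j = gen_orbit G y"
    unfolding j_def using bij_betw_inv_into_right[OF e] bij_betw_apply[OF bij_betw_inv_into[OF e]]
    by (auto simp: gen_orbits_def)
  have "y \<in> e i \<longleftrightarrow> i = j" if "i < K" for i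
  proof
    assume "y \<in> e i"
    moreover have "e i \<in> gen_orbits G" using bij_betw_apply[OF e] that by simp
    ultimately have "e i = e j"
      using gen_orbits_disjoint[OF G] gen_orbit_self j(2) by (metis rangeI gen_orbits_def)
    then show "i = j" using bij_betw_imp_inj_on[OF e] that j(1) by (auto dest: inj_onD)
  qed (use j(2) gen_orbit_self in simp)
  then have "(\<Sum>i<K. c i *s indicator_vec (e i)) $ y = (\<Sum>i<K. if i = j then c i else 0)"
    unfolding sum_component indicator_vec_def by (intro sum.cong) auto
  also have "\<dots> = c j" using j(1) by (simp add: sum.delta')
  finally show ?thesis unfolding j_def .
qed

lemma is_cbasis_fixed_space:
  fixes G :: "('n::finite \<Rightarrow> 'n) set"
  assumes G: "\<forall>g\<in>G. g permutes UNIV"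
    and e: "bij_betw e {..<card (gen_orbits G)} (gen_orbits G)"
  shows "is_cbasis (fixed_space G) (card (gen_orbits G)) (indicator_vec \<circ> e)"
proof -
  define K where "K = card (gen_orbits G)"
  have Gb: "\<forall>g\<in>G. bij g" using G permutes_bij by blast
  have e: "bij_betw e {..<K} (gen_orbits G)" using e unfolding K_def .
  note nth = sum_indicator_vec_gen_orbits_nth[OF Gb e]
  show ?thesis unfolding K_def[symmetric]
  proof (rule is_cbasisI)
    fix c assume "(\<Sum>i<K. c i *s (indicator_vec \<circ> e) i) = 0"
    then have "c (inv_into {..<K} e (gen_orbit G y)) = 0" for y using nth[of c y] by simp
    moreover have "\<forall>i<K. \<exists>y. inv_into {..<K} e (gen_orbit G y) = i"
      using bij_betw_apply[OF e] bij_betw_inv_into_left[OF e] unfolding gen_orbits_def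
      by (metis lessThan_iff rangeE)
    ultimately show "\<forall>i<K. c i = 0" by metis
  next
    have "vec.span ((indicator_vec \<circ> e) ` {..<K}) \<subseteq> fixed_space G"
      using indicator_vec_mem_fixed_space[OF G] bij_betw_apply[OF e]
      by (intro vec.span_minimal subspace_fixed_space) auto
    moreover have "x \<in> vec.span ((indicator_vec \<circ> e) ` {..<K})" if x: "x \<in> fixed_space G" for x
    proof -
      define c where "c i = x $ (SOME y. y \<in> e i)" for i
      have "x $ y = (\<Sum>i<K. c i *s indicator_vec (e i)) $ y" for y
      proof -
        have "(SOME z. z \<in> gen_orbit G y) \<in> gen_orbit G y" using gen_orbit_self by (rule someI)
        then have "x $ (SOME z. z \<in> gen_orbit G y) = x $ y"
          using x unfolding mem_fixed_space_iff[OF G] gen_orbit_def by auto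
        moreover have "e (inv_into {..<K} e (gen_orbit G y)) = gen_orbit G y"
          using bij_betw_inv_into_right[OF e] by (simp add: gen_orbits_def)
        ultimately show ?thesis unfolding nth c_def by simp
      qed
      then have "x = (\<Sum>i<K. c i *s (indicator_vec \<circ> e) i)"
        by (simp add: Finite_Cartesian_Product.vec_eq_iff)
      then show ?thesis using sum_scale_in_span by metis
    qed
    ultimately show "vec.span ((indicator_vec \<circ> e) ` {..<K}) = fixed_space G" by blast
  qed
qed

lemma dim_fixed_space:
  fixes G :: "('n::finite \<Rightarrow> 'n) set"
  assumes "\<forall>g\<in>G. g permutes UNIV"
  shows "vec.dim (fixed_space G) = card (gen_orbits G)"
proof -
  obtain e where "bij_betw e {..<card (gen_orbits G)} (gen_orbits G)"
    using ex_bij_betw_nat_finite[OF finite_gen_orbits] by (auto simp: lessThan_atLeast0)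
  then show ?thesis using is_cbasis_dim is_cbasis_fixed_space[OF assms] by blast
qed

lemma det_on_fixed_space:
  fixes G :: "('n::finite \<Rightarrow> 'n) set"
  assumes G: "\<forall>g\<in>G. g permutes UNIV" and v: "v permutes UNIV" and commute: "\<forall>g\<in>G. v \<circ> g = g \<circ> v"
  shows "det_on (perm_mat v) (fixed_space G) = of_int (sign (orbit_perm G v))"
proof -
  have Gb: "\<forall>g\<in>G. bij g" using G permutes_bij by blast
  obtain e where e: "bij_betw e {..<card (gen_orbits G)} (gen_orbits G)"
    using ex_bij_betw_nat_finite[OF finite_gen_orbits] by (auto simp: lessThan_atLeast0)
  show ?thesis
  proof (rule det_on_permuting_basis[OF e is_cbasis_fixed_space[OF G e]])
    show "orbit_perm G v permutes gen_orbits G"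
      by (rule orbit_perm_permutes[OF Gb permutes_bij[OF v] commute])
    show "\<forall>X\<in>gen_orbits G. perm_mat v *v indicator_vec X = indicator_vec (orbit_perm G v X)"
      unfolding perm_mat_indicator_vec[OF v] orbit_perm_def by simp
  qed
qed

section \<open>Eigenspace decomposition of a matrix of finite order\<close>

definition unit_root :: "nat \<Rightarrow> complex" where
  "unit_root m = exp (2 * of_real pi * \<i> / of_nat m)"

lemma unit_root_pow_eq_1_iff:
  assumes "m > 0" shows "unit_root m ^ k = 1 \<longleftrightarrow> m dvd k"
proof -
  have "unit_root m ^ k = exp (2 * of_real pi * \<i> * of_nat k / of_nat m)"
    unfolding unit_root_def exp_of_nat_mult[symmetric] by (simp add: mult.commute)
  then show ?thesis using complex_root_unity_eq_1[of m k] assms by simp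
qed

lemma unit_root_nonzero [simp]: "unit_root m \<noteq> 0"
  unfolding unit_root_def by simp

lemma sum_lessThan_shift_periodic:
  fixes g :: "nat \<Rightarrow> 'a::ab_group_add"
  assumes "g m = g 0" shows "(\<Sum>t<m. g (Suc t)) = (\<Sum>t<m. g t)"
proof -
  have "g 0 + (\<Sum>t<m. g (Suc t)) = (\<Sum>t<m. g t) + g m"
    using sum.lessThan_Suc_shift[of g m] by simp
  with assms show ?thesis by (simp add: algebra_simps)
qed

lemma funpow_mult_vec_add:
  fixes U :: "'a::semiring_1^'n^'n"
  shows "((*v) U ^^ t) (x + y) = ((*v) U ^^ t) x + ((*v) U ^^ t) y"
  by (induction t) (simp_all add: matrix_vector_right_distrib)

lemma funpow_mult_vec_scale:
  fixes U :: "'a::field^'n^'n"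
  shows "((*v) U ^^ t) (c *s x) = c *s ((*v) U ^^ t) x"
  by (induction t) (simp_all add: vector_scalar_commute)

definition fourier_component :: "complex^'n^'n \<Rightarrow> nat \<Rightarrow> nat \<Rightarrow> complex^'n \<Rightarrow> complex^'n" where
  "fourier_component U m r x = (1 / of_nat m) *s (\<Sum>t<m. unit_root m ^ (r * t) *s ((*v) U ^^ t) x)"

lemma fourier_component_add:
  "fourier_component U m r (x + y) = fourier_component U m r x + fourier_component U m r y"
  unfolding fourier_component_def funpow_mult_vec_add
  by (simp add: sum.distrib vector_add_ldistrib)

lemma fourier_component_scale: "fourier_component U m r (c *s x) = c *s fourier_component U m r x"
proof -
  have "(\<Sum>t<m. unit_root m ^ (r * t) *s (c *s ((*v) U ^^ t) x))
      = c *s (\<Sum>t<m. unit_root m ^ (r * t) *s ((*v) U ^^ t) x)"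
    by (simp add: vec.scale_sum_right vector_smult_assoc mult.commute)
  then show ?thesis
    unfolding fourier_component_def funpow_mult_vec_scale
    by (simp add: vector_smult_assoc mult.commute)
qed

lemma fourier_component_mult_vec:
  "fourier_component U m r (U *v x) = U *v fourier_component U m r x"
  unfolding fourier_component_def funpow_swap1[of "(*v) U", symmetric]
  by (simp add: vector_scalar_commute vec.sum)

context
  fixes U :: "complex^'n^'n" and m :: nat
  assumes m: "m > 0" and order: "(*v) U ^^ m = id"
begin

lemma mult_vec_fourier_component:
  "U *v fourier_component U m r x = inverse (unit_root m ^ r) *s fourier_component U m r x"
proof -
  define g where "g t = unit_root m ^ (r * t) *s ((*v) U ^^ t) x" for t
  have "g m = g 0"
    using unit_root_pow_eq_1_iff[OF m, of "r * m"] order unfolding g_def by simp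
  have gS: "g (Suc t) = unit_root m ^ r *s (unit_root m ^ (r * t) *s (U *v ((*v) U ^^ t) x))" for t
    unfolding g_def by (simp add: vector_smult_assoc power_add)
  have "unit_root m ^ r *s (U *v fourier_component U m r x)
      = (1 / of_nat m)
        *s (\<Sum>t<m. unit_root m ^ r *s (unit_root m ^ (r * t) *s (U *v ((*v) U ^^ t) x)))"
    unfolding fourier_component_def
    by (simp add: vector_scalar_commute vec.sum vec.scale_sum_right vector_smult_assoc mult.commute)
  also have "\<dots> = (1 / of_nat m) *s (\<Sum>t<m. g (Suc t))" by (simp only: gS)
  also have "\<dots> = (1 / of_nat m) *s (\<Sum>t<m. g t)"
    by (simp only: sum_lessThan_shift_periodic[OF \<open>g m = g 0\<close>])
  also have "\<dots> = fourier_component U m r x" unfolding fourier_component_def g_def ..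
  finally have "unit_root m ^ r *s (U *v fourier_component U m r x) = fourier_component U m r x" .
  then have "inverse (unit_root m ^ r) *s (unit_root m ^ r *s (U *v fourier_component U m r x))
      = inverse (unit_root m ^ r) *s fourier_component U m r x" by simp
  then show ?thesis by (simp add: vector_smult_assoc)
qed

lemma sum_fourier_components: "(\<Sum>r<m. fourier_component U m r x) = x"
proof -
  have geometric: "(\<Sum>r<m. unit_root m ^ (r * t)) = (if t = 0 then of_nat m else 0)"
    if "t < m" for t
  proof (cases "t = 0")
    case False
    have "unit_root m ^ t \<noteq> 1" using unit_root_pow_eq_1_iff[OF m] False that
      by (auto dest: dvd_imp_le)
    then have "(\<Sum>r<m. (unit_root m ^ t) ^ r) = ((unit_root m ^ t) ^ m - 1) / (unit_root m ^ t - 1)"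
      by (rule geometric_sum)
    also have "(unit_root m ^ t) ^ m = 1"
      using unit_root_pow_eq_1_iff[OF m, of "t * m"] by (simp add: power_mult)
    finally show ?thesis using False by (simp add: power_mult[symmetric] mult.commute)
  qed simp
  have "(\<Sum>r<m. fourier_component U m r x)
      = (1 / of_nat m) *s (\<Sum>r<m. \<Sum>t<m. unit_root m ^ (r * t) *s ((*v) U ^^ t) x)"
    unfolding fourier_component_def by (simp add: vec.scale_sum_right)
  also have "(\<Sum>r<m. \<Sum>t<m. unit_root m ^ (r * t) *s ((*v) U ^^ t) x)
      = (\<Sum>t<m. \<Sum>r<m. unit_root m ^ (r * t) *s ((*v) U ^^ t) x)"
    by (rule sum.swap)
  also have "\<dots> = (\<Sum>t<m. (\<Sum>r<m. unit_root m ^ (r * t)) *s ((*v) U ^^ t) x)"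
    by (simp add: vec.scale_sum_left)
  also have "\<dots> = (\<Sum>t<m. if t = 0 then of_nat m *s x else 0)"
    by (rule sum.cong) (simp_all add: geometric)
  also have "\<dots> = of_nat m *s x" using m by (simp add: sum.delta)
  finally show ?thesis using m by (simp add: vector_smult_assoc)
qed

lemma fourier_component_0_Fix: "x \<in> Fix U \<Longrightarrow> fourier_component U m 0 x = x"
proof -
  assume "x \<in> Fix U"
  then have "((*v) U ^^ t) x = x" for t by (induction t) (simp_all add: Fix_def)
  then have "(\<Sum>t<m. unit_root m ^ (0 * t) *s ((*v) U ^^ t) x) = (\<Sum>t<m. (1::complex)) *s x"
    by (simp add: vec.scale_sum_left del: sum_constant)
  then have "fourier_component U m 0 x = (1 / of_nat m) *s (of_nat m *s x)"
    unfolding fourier_component_def by simp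
  also have "\<dots> = x" using m by (simp add: vector_smult_assoc)
  finally show ?thesis .
qed

lemma fourier_component_0_M_sp: "x \<in> M_sp U \<Longrightarrow> fourier_component U m 0 x = 0"
  unfolding M_sp_def
proof (induction rule: vec.span_induct_alt)
  case (step c x y)
  then obtain d where d: "d \<noteq> 1" "U *v x = d *s x" by blast
  have "d *s fourier_component U m 0 x = fourier_component U m 0 (U *v x)"
    unfolding d(2) fourier_component_scale ..
  also have "\<dots> = fourier_component U m 0 x"
    using mult_vec_fourier_component[of 0 x] by (simp add: fourier_component_mult_vec)
  finally have "(d - 1) *s fourier_component U m 0 x = 0" by (simp add: vector_sub_rdistrib)
  then have "d - 1 = 0 \<or> fourier_component U m 0 x = 0" by (simp only: vector_mul_eq_0)
  with d(1) have "fourier_component U m 0 x = 0" by simp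
  with step show ?case by (simp add: fourier_component_add fourier_component_scale)
qed (use fourier_component_scale[of U m 0 0 0] in simp)

lemma Fix_inter_M_sp:
  assumes "y \<in> Fix U" "y \<in> M_sp U" shows "y = 0"
  using fourier_component_0_Fix[OF assms(1)] fourier_component_0_M_sp[OF assms(2)] by simp

lemma Fix_plus_M_sp: "\<exists>x1\<in>Fix U. \<exists>x2\<in>M_sp U. x = x1 + x2"
proof -
  obtain m' where m': "m = Suc m'" using m by (cases m) auto
  have "x = (\<Sum>r<Suc m'. fourier_component U m r x)" using sum_fourier_components[of x] m' by simp
  also have "\<dots> = fourier_component U m 0 x + (\<Sum>r<m'. fourier_component U m (Suc r) x)"
    by (rule sum.lessThan_Suc_shift)
  finally have x: "x = fourier_component U m 0 x + (\<Sum>r<m'. fourier_component U m (Suc r) x)" .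
  have "fourier_component U m 0 x \<in> Fix U"
    using mult_vec_fourier_component[of 0 x] by (simp add: Fix_def)
  moreover have "(\<Sum>r<m'. fourier_component U m (Suc r) x) \<in> M_sp U"
    unfolding M_sp_def
  proof (intro vec.span_sum vec.span_base)
    fix r assume "r \<in> {..<m'}"
    then have "\<not> m dvd Suc r" using m' by (auto dest: dvd_imp_le)
    then have "unit_root m ^ Suc r \<noteq> 1" using unit_root_pow_eq_1_iff[OF m] by blast
    then have "inverse (unit_root m ^ Suc r) \<noteq> 1" by (metis inverse_1 inverse_inverse_eq)
    then show "fourier_component U m (Suc r) x \<in> (\<Union>c\<in>- {1}. {x. U *v x = c *s x})"
      using mult_vec_fourier_component by blast
  qed
  ultimately show ?thesis using x by blast
qed

end

section \<open>The pull-back coefficients of two commuting even permutations\<close>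

lemma perm_mat_finite_order:
  fixes u :: "'n::finite \<Rightarrow> 'n"
  assumes u: "u permutes UNIV"
  obtains m where "m > 0" "(*v) (perm_mat u) ^^ m = id"
proof -
  obtain m where m: "m > 0" "u ^^ m = id" using bij_funpow_eq_id[OF permutes_bij[OF u]] by blast
  have "((*v) (perm_mat u) ^^ m) x = x" for x
    using perm_mat_funpow[OF u, of m x] perm_mat_mult_vec[OF permutes_id, of x] m(2)
    by (simp add: Finite_Cartesian_Product.vec_eq_iff)
  with m(1) show ?thesis by (intro that) auto
qed

lemma M_sp_invariant:
  assumes commute: "\<And>y. A *v (U *v y) = U *v (A *v y)" and "x \<in> M_sp U"
  shows "A *v x \<in> M_sp U"
  using assms(2) unfolding M_sp_def
proof (induction rule: vec.span_induct_alt)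
  case (step c x y)
  then obtain d where "d \<noteq> 1" "U *v x = d *s x" by blast
  then have "U *v (A *v x) = d *s (A *v x)" using commute[of x] by (simp add: vector_scalar_commute)
  with \<open>d \<noteq> 1\<close> have "A *v x \<in> vec.span (\<Union>c\<in>- {1}. {x. U *v x = c *s x})"
    by (intro vec.span_base) blast
  with step(2) show ?case
    by (simp add: matrix_vector_right_distrib vector_scalar_commute vec.span_add vec.span_scale)
qed (simp add: vec.span_zero)

lemma det_on_perm_mat_UNIV:
  fixes v :: "'n::finite \<Rightarrow> 'n"
  assumes v: "v permutes UNIV" shows "det_on (perm_mat v) UNIV = of_int (sign v)"
proof -
  have "fixed_space ({} :: ('n \<Rightarrow> 'n) set) = UNIV" unfolding fixed_space_def by simp
  then have "det_on (perm_mat v) UNIV = of_int (sign (orbit_perm {} v))"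
    using det_on_fixed_space[of "{}" v] v by simp
  also have "sign (orbit_perm {} v) = sign v"
    unfolding orbit_perm_empty[OF permutes_bij[OF v]] by (intro sign_map_permutation v) auto
  finally show ?thesis .
qed

lemma pullback_coeff_perm_mat:
  fixes u v :: "'n::finite \<Rightarrow> 'n"
  assumes u: "u permutes UNIV" and v: "v permutes UNIV" and commute: "u \<circ> v = v \<circ> u"
    and ev: "evenperm v"
  shows "pullback_coeff (perm_mat v) (perm_mat u) = of_int (sign (orbit_perm {u} v))"
proof -
  obtain m where m: "m > 0" "(*v) (perm_mat u) ^^ m = id" using perm_mat_finite_order[OF u] .
  have UV: "perm_mat v *v (perm_mat u *v y) = perm_mat u *v (perm_mat v *v y)" for y
    unfolding perm_mat_comp[OF u v] perm_mat_comp[OF v u] commute ..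
  have Fix: "Fix (perm_mat u) = fixed_space {u}" unfolding Fix_def fixed_space_def by simp
  have "det_on (perm_mat v) UNIV
      = det_on (perm_mat v) (Fix (perm_mat u)) * det_on (perm_mat v) (M_sp (perm_mat u))"
  proof (rule det_on_direct_sum)
    show "vec.subspace (M_sp (perm_mat u))" unfolding M_sp_def by (rule vec.subspace_span)
    show "vec.subspace (Fix (perm_mat u))" unfolding Fix by (rule subspace_fixed_space)
    show "\<forall>x\<in>Fix (perm_mat u). perm_mat v *v x \<in> Fix (perm_mat u)"
      unfolding Fix_def by (simp add: UV[symmetric])
    show "\<forall>x\<in>M_sp (perm_mat u). perm_mat v *v x \<in> M_sp (perm_mat u)"
      using M_sp_invariant UV by blast
  qed (use Fix_inter_M_sp[OF m] Fix_plus_M_sp[OF m] in auto)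
  moreover have "det_on (perm_mat v) (Fix (perm_mat u)) = of_int (sign (orbit_perm {u} v))"
    unfolding Fix using det_on_fixed_space[of "{u}" v] u v commute by simp
  ultimately have "of_int (sign (orbit_perm {u} v)) * det_on (perm_mat v) (M_sp (perm_mat u)) = 1"
    using ev det_on_perm_mat_UNIV[OF v] by (simp add: sign_def)
  moreover have "of_int (sign p) * of_int (sign p) = (1::complex)" for p
    by (simp add: sign_def)
  ultimately show ?thesis
    unfolding pullback_coeff_def by (metis inverse_unique mult.left_neutral mult.assoc)
qed

lemma pullback_coeff_perm_mat_pair:
  fixes u v :: "'n::finite \<Rightarrow> 'n"
  assumes u: "u permutes UNIV" and v: "v permutes UNIV" and commute: "u \<circ> v = v \<circ> u"
    and eu: "evenperm u" and ev: "evenperm v"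
  shows "pullback_coeff (perm_mat v) (perm_mat u)
      = (if even (CARD('n) + card (gen_orbits {u, v})) then 1 else -1)"
proof -
  have "evenperm (orbit_perm {u} v) \<longleftrightarrow> even (card (gen_orbits {u}) + card (gen_orbits {v, u}))"
    by (rule evenperm_orbit_perm_iff) (use u v commute permutes_bij in auto)
  moreover have "even (CARD('n) + card (gen_orbits {u}))"
    using evenperm_iff_card_gen_orbits[OF permutes_bij[OF u]] eu by simp
  ultimately have "evenperm (orbit_perm {u} v) \<longleftrightarrow> even (CARD('n) + card (gen_orbits {u, v}))"
    by (simp add: insert_commute)
  then show ?thesis
    unfolding pullback_coeff_perm_mat[OF u v commute ev] by (simp add: sign_def)
qed

lemma parity_condition_iff:
  fixes u v :: "'n::finite \<Rightarrow> 'n"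
  assumes u: "u permutes UNIV" and v: "v permutes UNIV" and commute: "u \<circ> v = v \<circ> u"
    and eu: "evenperm u" and ev: "evenperm v"
  shows "parity_condition (perm_gen {u, v}) \<longleftrightarrow> even (CARD('n) + card (gen_orbits {u, v}))"
proof -
  have bij: "bij u" "bij v" using u v permutes_bij by blast+
  have "vec.dim (fixed_space H) = card (gen_orbits H)" if "H \<subseteq> perm_gen {u, v}" for H
    using that perm_gen_bij[of "{u, v}"] bij
    by (intro dim_fixed_space) (auto intro: bij_imp_permutes)
  moreover have T: "is_subgroup (perm_gen {u, v}) (perm_gen {u, v})"
    unfolding is_subgroup_def using perm_gen.gen_id perm_gen.gen_comp perm_gen.gen_inv by blast
  moreover have "gen_orbits (perm_gen {u, v}) = gen_orbits {u, v}"
    by (rule gen_orbits_cong[OF perm_gen_subgroup[OF T]])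
  ultimately show ?thesis
    unfolding parity_condition_def
    using even_card_gen_orbits_subgroup[OF bij commute eu ev]
    by (metis add.commute is_subgroup_def)
qed

theorem proposition8:
  fixes u v :: "'n::finite \<Rightarrow> 'n"
  assumes "u permutes (UNIV :: 'n set)" and "v permutes (UNIV :: 'n set)"
    and "evenperm u" and "evenperm v"
    and "u \<circ> v = v \<circ> u"
  shows "(parity_condition (perm_gen {u, v}) \<longleftrightarrow>
            pullback_coeff (perm_mat u) (perm_mat v) = 1 \<and>
            pullback_coeff (perm_mat v) (perm_mat u) = 1)
       \<and> (\<not> parity_condition (perm_gen {u, v}) \<longrightarrow>
            pullback_coeff (perm_mat u) (perm_mat v) = -1 \<or>
            pullback_coeff (perm_mat v) (perm_mat u) = -1)"
proof -
  let ?even = "even (CARD('n) + card (gen_orbits {u, v}))"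
  have "pullback_coeff (perm_mat v) (perm_mat u) = (if ?even then 1 else -1)"
    by (rule pullback_coeff_perm_mat_pair[OF assms(1,2,5,3,4)])
  moreover have "pullback_coeff (perm_mat u) (perm_mat v) = (if ?even then 1 else -1)"
    using pullback_coeff_perm_mat_pair[OF assms(2,1) assms(5)[symmetric] assms(4,3)]
    by (simp add: insert_commute)
  moreover have "parity_condition (perm_gen {u, v}) \<longleftrightarrow> ?even"
    by (rule parity_condition_iff[OF assms(1,2,5,3,4)])
  ultimately show ?thesis by simp
qed

end
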